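(* Let $\Omega$ be a bounded Lipschitz domain in $\mathbb{R}^N$, $N\ge1$, and let $B$ be an $N$-function. There exist constants $c_1,c_2>0$ depending on $\Omega$ such that for every $u\in W^{1,B}_0(\Omega)$ $$\int_\Omega B(c_1|u|)\,dx\le c_2\int_\Omega B(|\nabla u|)\,dx .$$
   Context: $B:[0,\infty)\to[0,\infty)$ is an $N$-function if it is strictly increasing, convex, $\lim_{r\to0}B(r)/r=0$ and $\lim_{r\to\infty}B(r)/r=\infty$; no further growth condition (such as $\Delta_2$) is assumed. Its conjugate is $\widetilde B(s)=\sup_{t>0}(ts-B(t))$. $L_B(\Omega)$ is the linear span of measurable $\xi$ with $\int_\Omega B(|\xi|)\,dx<\infty$, with the Luxemburg norm $\|\xi\|_{L_B}=\inf\{\lambda>0:\int_\Omega B(|\xi|/\lambda)\,dx\le1\}$; $E_B(\Omega)$ is the closure of bounded functions in the $L_B$-norm. $W^{1,B}(\Omega)=\{u\in W^{1,1}(\Omega):u,\nabla u\in L_B(\Omega)\}$, and $W^{1,B}_0(\Omega)$ is the closure of $C_0^\infty(\Omega)$ in $W^{1,B}(\Omega)$ with respect to the topology $\sigma(L_B,E_{\widetilde B})$ (for functions and their gradients). *)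

theory Defs
  imports "HOL-Analysis.Analysis"
begin

text \<open>
  Functions on \<open>\<Omega>\<close> are total functions on the ambient space whose values outside \<open>\<Omega>\<close> are
  irrelevant: measurability and integrals refer to \<open>lebesgue_on \<Omega>\<close>. Elements of the function
  spaces are representatives rather than classes modulo null sets.
\<close>

subsection \<open>Lipschitz domains\<close>

text \<open>
  The unit vector \<open>e\<close> is the local vertical axis, and \<open>y - (y \<bullet> e) *\<^sub>R e\<close> is the projection of
  \<open>y\<close> to the hyperplane orthogonal to \<open>e\<close>. Locally \<open>\<Omega>\<close> is the strict epigraph of a
  Lipschitz function on that hyperplane (which is \<open>{0}\<close> in dimension one).
\<close>

definition lipschitz_boundary :: "'a::euclidean_space set \<Rightarrow> bool" where
  "lipschitz_boundary \<Omega> \<longleftrightarrow>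
     (\<forall>x\<in>frontier \<Omega>. \<exists>r>0. \<exists>e. \<exists>L. \<exists>\<gamma>::'a \<Rightarrow> real.
        norm e = 1 \<and> L-lipschitz_on {z. z \<bullet> e = 0} \<gamma> \<and>
        \<Omega> \<inter> ball x r = {y \<in> ball x r. \<gamma> (y - (y \<bullet> e) *\<^sub>R e) < y \<bullet> e})"

definition lipschitz_domain :: "'a::euclidean_space set \<Rightarrow> bool" where
  "lipschitz_domain \<Omega> \<longleftrightarrow> \<Omega> \<noteq> {} \<and> open \<Omega> \<and> connected \<Omega> \<and> lipschitz_boundary \<Omega>"

subsection \<open>N-functions\<close>

text \<open>Only the values on \<open>{0..}\<close> matter.\<close>

definition N_function :: "(real \<Rightarrow> real) \<Rightarrow> bool" where
  "N_function B \<longleftrightarrow>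
     (\<forall>r\<ge>0. 0 \<le> B r) \<and> strict_mono_on {0..} B \<and> convex_on {0..} B \<and>
     ((\<lambda>r. B r / r) \<longlongrightarrow> 0) (at_right 0) \<and> filterlim (\<lambda>r. B r / r) at_top at_top"

definition conjugate_fun :: "(real \<Rightarrow> real) \<Rightarrow> real \<Rightarrow> real" where
  "conjugate_fun B s = (SUP t\<in>{0<..}. t * s - B t)"

subsection \<open>Orlicz spaces\<close>

definition modular :: "(real \<Rightarrow> real) \<Rightarrow> 'a::euclidean_space set \<Rightarrow> ('a \<Rightarrow> 'b::euclidean_space) \<Rightarrow> ennreal"
  where "modular B \<Omega> \<xi> = (\<integral>\<^sup>+x. ennreal (B (norm (\<xi> x))) \<partial>lebesgue_on \<Omega>)"

definition orlicz_class ::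
    "(real \<Rightarrow> real) \<Rightarrow> 'a::euclidean_space set \<Rightarrow> ('a \<Rightarrow> 'b::euclidean_space) set" where
  "orlicz_class B \<Omega> = {\<xi> \<in> borel_measurable (lebesgue_on \<Omega>). modular B \<Omega> \<xi> < \<infinity>}"

text \<open>The linear span is written out because function types are not an instance of
  \<open>real_vector\<close>.\<close>

definition orlicz_space ::
    "(real \<Rightarrow> real) \<Rightarrow> 'a::euclidean_space set \<Rightarrow> ('a \<Rightarrow> 'b::euclidean_space) set" where
  "orlicz_space B \<Omega> =
     {\<lambda>x. \<Sum>i<n. c i *\<^sub>R \<zeta> i x | (n::nat) (c::nat \<Rightarrow> real) (\<zeta>::nat \<Rightarrow> 'a \<Rightarrow> 'b).
        \<forall>i<n. \<zeta> i \<in> orlicz_class B \<Omega>}"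

definition luxemburg_norm ::
    "(real \<Rightarrow> real) \<Rightarrow> 'a::euclidean_space set \<Rightarrow> ('a \<Rightarrow> 'b::euclidean_space) \<Rightarrow> real" where
  "luxemburg_norm B \<Omega> \<xi> = Inf {l. 0 < l \<and> modular B \<Omega> (\<lambda>x. \<xi> x /\<^sub>R l) \<le> 1}"

text \<open>On sets of finite measure, the case of interest, all bounded measurable functions lie in
  \<open>orlicz_space B \<Omega>\<close>.\<close>

definition orlicz_E ::
    "(real \<Rightarrow> real) \<Rightarrow> 'a::euclidean_space set \<Rightarrow> ('a \<Rightarrow> 'b::euclidean_space) set" where
  "orlicz_E B \<Omega> =
     {\<xi> \<in> orlicz_space B \<Omega>. \<forall>\<epsilon>>0. \<exists>\<eta>\<in>orlicz_space B \<Omega>.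
        bounded (\<eta> ` \<Omega>) \<and> luxemburg_norm B \<Omega> (\<lambda>x. \<xi> x - \<eta> x) < \<epsilon>}"

text \<open>The topology \<open>\<sigma>(L, E)\<close> on the Orlicz space \<open>L\<close> of \<open>B\<close>, where \<open>E\<close> belongs to the conjugate
  of \<open>B\<close>: the coarsest one making \<open>\<xi> \<mapsto> \<integral> \<xi> \<bullet> \<eta>\<close> continuous for every \<open>\<eta> \<in> E\<close>.\<close>

definition orlicz_weak_topology ::
    "(real \<Rightarrow> real) \<Rightarrow> 'a::euclidean_space set \<Rightarrow> ('a \<Rightarrow> 'b::euclidean_space) topology" where
  "orlicz_weak_topology B \<Omega> =
     pullback_topology (orlicz_space B \<Omega>)
       (\<lambda>\<xi>. \<lambda>\<eta>\<in>orlicz_E (conjugate_fun B) \<Omega>. LINT x|lebesgue_on \<Omega>. \<xi> x \<bullet> \<eta> x)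
       (powertop_real (orlicz_E (conjugate_fun B) \<Omega>))"

subsection \<open>Test functions and weak gradients\<close>

primrec times_differentiable :: "nat \<Rightarrow> ('a::euclidean_space \<Rightarrow> real) \<Rightarrow> bool" where
  "times_differentiable 0 f \<longleftrightarrow> continuous_on UNIV f"
| "times_differentiable (Suc n) f \<longleftrightarrow>
     (\<forall>x. f differentiable at x) \<and>
     (\<forall>v. times_differentiable n (\<lambda>x. frechet_derivative f (at x) v))"

definition test_functions :: "'a::euclidean_space set \<Rightarrow> ('a \<Rightarrow> real) set" where
  "test_functions \<Omega> =
     {\<phi>. (\<forall>n. times_differentiable n \<phi>) \<and>
         compact (closure {x. \<phi> x \<noteq> 0}) \<and> closure {x. \<phi> x \<noteq> 0} \<subseteq> \<Omega>}"

definition locally_integrable ::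
    "'a::euclidean_space set \<Rightarrow> ('a \<Rightarrow> 'b::euclidean_space) \<Rightarrow> bool" where
  "locally_integrable \<Omega> f \<longleftrightarrow> (\<forall>K. compact K \<and> K \<subseteq> \<Omega> \<longrightarrow> integrable (lebesgue_on K) f)"

definition has_weak_gradient ::
    "'a::euclidean_space set \<Rightarrow> ('a \<Rightarrow> real) \<Rightarrow> ('a \<Rightarrow> 'a) \<Rightarrow> bool" where
  "has_weak_gradient \<Omega> u g \<longleftrightarrow>
     locally_integrable \<Omega> u \<and> locally_integrable \<Omega> g \<and>
     (\<forall>\<phi>\<in>test_functions \<Omega>. \<forall>i\<in>Basis.
        (LINT x|lebesgue_on \<Omega>. u x * frechet_derivative \<phi> (at x) i) =
        - (LINT x|lebesgue_on \<Omega>. (g x \<bullet> i) * \<phi> x))"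

text \<open>For open \<open>\<Omega>\<close>, weak gradients are unique up to null sets; this picks a representative.\<close>

definition weak_gradient :: "'a::euclidean_space set \<Rightarrow> ('a \<Rightarrow> real) \<Rightarrow> 'a \<Rightarrow> 'a" where
  "weak_gradient \<Omega> u = (SOME g. has_weak_gradient \<Omega> u g)"

subsection \<open>Orlicz-Sobolev spaces\<close>

definition sobolev_W11 :: "'a::euclidean_space set \<Rightarrow> ('a \<Rightarrow> real) set" where
  "sobolev_W11 \<Omega> =
     {u. integrable (lebesgue_on \<Omega>) u \<and> (\<exists>g. has_weak_gradient \<Omega> u g) \<and>
         integrable (lebesgue_on \<Omega>) (weak_gradient \<Omega> u)}"

definition orlicz_sobolev ::
    "(real \<Rightarrow> real) \<Rightarrow> 'a::euclidean_space set \<Rightarrow> ('a \<Rightarrow> real) set" where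
  "orlicz_sobolev B \<Omega> =
     {u \<in> sobolev_W11 \<Omega>. u \<in> orlicz_space B \<Omega> \<and> weak_gradient \<Omega> u \<in> orlicz_space B \<Omega>}"

definition orlicz_sobolev_topology ::
    "(real \<Rightarrow> real) \<Rightarrow> 'a::euclidean_space set \<Rightarrow> ('a \<Rightarrow> real) topology" where
  "orlicz_sobolev_topology B \<Omega> =
     pullback_topology (orlicz_sobolev B \<Omega>) (\<lambda>u. (u, weak_gradient \<Omega> u))
       (prod_topology (orlicz_weak_topology B \<Omega>) (orlicz_weak_topology B \<Omega>))"

definition orlicz_sobolev_0 ::
    "(real \<Rightarrow> real) \<Rightarrow> 'a::euclidean_space set \<Rightarrow> ('a \<Rightarrow> real) set" where
  "orlicz_sobolev_0 B \<Omega> = orlicz_sobolev_topology B \<Omega> closure_of test_functions \<Omega>"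

end

theory Submission
  imports Defs
begin

text \<open>
  Fix a coordinate direction \<open>e\<close> and \<open>d > 0\<close> so large that \<open>x + d *\<^sub>R e\<close> lies outside \<open>\<Omega>\<close> for all
  \<open>x \<in> \<Omega>\<close>. The heart of the matter is the representation
  \<open>u x = - \<integral>\<^sub>0\<^sup>d (\<nabla>u \<bullet> e) (x + t *\<^sub>R e) dt\<close> for almost every \<open>x \<in> \<Omega>\<close>, where \<open>\<nabla>u\<close> is extended by zero
  (lemma \<open>orlicz_sobolev_0_ray_integral\<close>). Jensen's inequality along the ray gives
  \<open>B (\<bar>u x\<bar> / d) \<le> 1 / d * \<integral>\<^sub>0\<^sup>d B \<bar>(\<nabla>u \<bullet> e) (x + t *\<^sub>R e)\<bar> dt\<close>, and integrating over \<open>x\<close> with Tonelli's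
  theorem and translation invariance yields the claim with constants \<open>1 / d\<close> and \<open>1\<close>, for
  all \<open>B\<close> at once (lemma \<open>orlicz_poincare\<close>).

  For a test function the representation is the fundamental theorem of calculus. To carry it over
  to the closure in the weak topology it is put in dual form: integrating against a bounded
  function \<open>w\<close> that vanishes outside \<open>\<Omega>\<close>, and using Fubini's theorem, it becomes
  \<open>\<integral> u w + \<integral> (\<nabla>u \<bullet> e) T = 0\<close> with \<open>T y = \<integral>\<^sub>0\<^sup>d w (y - t *\<^sub>R e) dt\<close>. Since \<open>w\<close> and \<open>T\<close> are bounded, they lie in
  the \<open>E\<close>-space of the conjugate of \<open>B\<close>, so the left side is a continuous functional of \<open>u\<close> and
  the identity survives in the closure; as \<open>w\<close> is arbitrary, the pointwise representation follows.
  No modular approximation by test functions is needed, and hence no growth condition on \<open>B\<close>.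

  One point remains: in the topology the gradient of a test function is the chosen weak gradient,
  which has to be identified with the classical one almost everywhere. This is the fundamental
  lemma of the calculus of variations, proved with smooth bump functions that converge to
  indicators of boxes.
\<close>

section \<open>Smooth functions\<close>

lemma times_differentiable_continuous:
  "times_differentiable n f \<Longrightarrow> continuous_on UNIV f"
proof (cases n)
  case (Suc m)
  moreover assume "times_differentiable n f"
  ultimately show ?thesis
    by (intro continuous_at_imp_continuous_on) (auto intro: differentiable_imp_continuous_within)
qed simp

lemma times_differentiable_Suc_imp:
  "times_differentiable (Suc n) f \<Longrightarrow> times_differentiable n f"
proof (induction n arbitrary: f)
  case 0
  then show ?case using times_differentiable_continuous[of "Suc 0" f] by simp
next
  case (Suc n)
  then show ?case by (subst times_differentiable.simps) simp
qed

lemma frechet_derivative_eqI: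
  "(f has_derivative f') (at x) \<Longrightarrow> frechet_derivative f (at x) = f'"
  by (metis frechet_derivative_at)

lemma frechet_derivative_works_at:
  "f differentiable at x \<Longrightarrow> (f has_derivative frechet_derivative f (at x)) (at x)"
  by (simp add: frechet_derivative_works)

lemma times_differentiable_add:
  "times_differentiable n f \<Longrightarrow> times_differentiable n g \<Longrightarrow> times_differentiable n (\<lambda>x. f x + g x)"
proof (induction n arbitrary: f g)
  case 0
  then show ?case by (simp add: continuous_on_add)
next
  case (Suc n)
  have "frechet_derivative (\<lambda>x. f x + g x) (at x) =
      (\<lambda>v. frechet_derivative f (at x) v + frechet_derivative g (at x) v)" for x
    using Suc.prems by (intro frechet_derivative_eqI has_derivative_add frechet_derivative_works_at) auto
  with Suc show ?case by simp
qed

lemma times_differentiable_mult: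
  "times_differentiable n f \<Longrightarrow> times_differentiable n g \<Longrightarrow> times_differentiable n (\<lambda>x. f x * g x)"
proof (induction n arbitrary: f g)
  case 0
  then show ?case by (simp add: continuous_on_mult)
next
  case (Suc n)
  have "frechet_derivative (\<lambda>x. f x * g x) (at x) =
      (\<lambda>v. f x * frechet_derivative g (at x) v + frechet_derivative f (at x) v * g x)" for x
    using Suc.prems by (intro frechet_derivative_eqI has_derivative_mult frechet_derivative_works_at) auto
  moreover have "times_differentiable n f" "times_differentiable n g"
    using Suc.prems times_differentiable_Suc_imp by blast+
  ultimately show ?case using Suc by (simp add: times_differentiable_add)
qed

lemma times_differentiable_const: "times_differentiable n (\<lambda>x. c)"
  by (induction n arbitrary: c) auto

lemma times_differentiable_prod:
  "(\<And>i. i \<in> I \<Longrightarrow> times_differentiable n (f i)) \<Longrightarrow> times_differentiable n (\<lambda>x. \<Prod>i\<in>I. f i x)"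
  by (induction I rule: infinite_finite_induct)
    (auto simp: times_differentiable_const times_differentiable_mult)

text \<open>
  The function \<open>exp (- 1 / t)\<close>, extended by \<open>0\<close> smoothly to \<open>t \<le> 0\<close>, with a polynomial factor
  in \<open>1 / t\<close>. With that factor the family is closed under differentiation.
\<close>
definition flat_exp :: "real poly \<Rightarrow> real \<Rightarrow> real" where
  "flat_exp p t = (if t \<le> 0 then 0 else poly p (1 / t) * exp (- (1 / t)))"

lemma flat_exp_nonpos: "t \<le> 0 \<Longrightarrow> flat_exp p t = 0"
  by (simp add: flat_exp_def)

lemma poly_exp_minus_tendsto_0:
  "((\<lambda>s::real. poly p s * exp (- s)) \<longlongrightarrow> 0) at_top"
proof -
  have "((\<lambda>s::real. \<Sum>i\<le>degree p. coeff p i * (s ^ i / exp s)) \<longlongrightarrow> (\<Sum>i\<le>degree p. coeff p i * 0)) at_top"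
    by (intro tendsto_sum tendsto_mult tendsto_const tendsto_power_div_exp_0)
  moreover have "(\<lambda>s::real. \<Sum>i\<le>degree p. coeff p i * (s ^ i / exp s)) = (\<lambda>s. poly p s * exp (- s))"
    by (simp add: poly_altdef exp_minus sum_distrib_right divide_inverse mult.assoc)
  ultimately show ?thesis by simp
qed

lemma flat_exp_has_real_derivative:
  "(flat_exp p has_real_derivative flat_exp ([:0, 0, 1:] * (p - pderiv p)) t) (at t)"
proof -
  consider "t < 0" | "t = 0" | "t > 0" by linarith
  then show ?thesis
  proof cases
    case 1
    have "((\<lambda>_. 0) has_real_derivative 0) (at t)" by simp
    then have "(flat_exp p has_real_derivative 0) (at t)"
    proof (rule has_field_derivative_transform_within_open[where S = "{..<0}"])
    qed (use 1 in \<open>auto simp: flat_exp_def\<close>)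
    then show ?thesis using 1 by (simp add: flat_exp_def)
  next
    case 2
    have "((\<lambda>h. (poly (pCons 0 p) (inverse h) * exp (- (inverse h)))) \<longlongrightarrow> 0) (at_right (0::real))"
      by (rule filterlim_compose[OF poly_exp_minus_tendsto_0 filterlim_inverse_at_top_right])
    then have "((\<lambda>h. flat_exp p h / h) \<longlongrightarrow> 0) (at_right 0)"
      by (rule Lim_transform_eventually)
        (auto simp: eventually_at_filter flat_exp_def field_simps)
    moreover have "((\<lambda>h. flat_exp p h / h) \<longlongrightarrow> 0) (at_left 0)"
      by (rule Lim_transform_eventually[OF tendsto_const])
        (auto simp: eventually_at_filter flat_exp_def)
    ultimately have "((\<lambda>h. flat_exp p h / h) \<longlongrightarrow> 0) (at 0)"
      by (simp add: filterlim_split_at)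
    then show ?thesis using 2 flat_exp_nonpos[of 0] by (simp add: DERIV_def)
  next
    case 3
    have "((\<lambda>t. poly p (1 / t) * exp (- (1 / t))) has_real_derivative
        flat_exp ([:0, 0, 1:] * (p - pderiv p)) t) (at t)"
      using 3 by (auto intro!: derivative_eq_intros DERIV_chain'[OF _ poly_DERIV]
          simp: flat_exp_def field_simps power2_eq_square)
    then show ?thesis
    proof (rule has_field_derivative_transform_within_open[where S = "{0<..}"])
    qed (use 3 in \<open>auto simp: flat_exp_def\<close>)
  qed
qed

lemma times_differentiable_flat_exp:
  fixes b :: "'a::euclidean_space"
  shows "times_differentiable n (\<lambda>x. flat_exp p (x \<bullet> b - c))"
proof (induction n arbitrary: p)
  case 0
  have "isCont (flat_exp p) t" for t
    using flat_exp_has_real_derivative DERIV_isCont by blast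
  then have "continuous_on UNIV (flat_exp p)"
    by (simp add: continuous_at_imp_continuous_on)
  then have "continuous_on UNIV (\<lambda>x::'a. flat_exp p (x \<bullet> b - c))"
    by (rule continuous_on_compose2) (auto intro!: continuous_intros)
  then show ?case by simp
next
  case (Suc n)
  let ?q = "[:0, 0, 1:] * (p - pderiv p)"
  have *: "((\<lambda>x. flat_exp p (x \<bullet> b - c)) has_derivative (\<lambda>v. (v \<bullet> b) * flat_exp ?q (x \<bullet> b - c))) (at x)" for x :: 'a
  proof -
    have "((\<lambda>x. x \<bullet> b - c) has_derivative (\<lambda>v. v \<bullet> b)) (at x)"
      by (auto intro!: derivative_eq_intros)
    from has_derivative_compose[OF this flat_exp_has_real_derivative[unfolded has_field_derivative_def]]
    show ?thesis by (simp add: mult.commute)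
  qed
  show ?case
    using * frechet_derivative_eqI[OF *]
    by (auto simp: differentiable_def intro!: times_differentiable_mult times_differentiable_const Suc)
qed

section \<open>Bump functions and the fundamental lemma of the calculus of variations\<close>

text \<open>
  Smooth functions supported in \<open>cbox a b\<close> that tend pointwise to the indicator of \<open>box a b\<close>: the
  factors \<open>exp (- 1 / t)\<close> are evaluated at \<open>(n + 1)\<close> times the distances to the faces. The arguments
  are written as \<open>x \<bullet> v - c\<close>, the shape in which smoothness of \<open>flat_exp\<close> is stated.
\<close>
definition box_bump :: "'a::euclidean_space \<Rightarrow> 'a \<Rightarrow> nat \<Rightarrow> 'a \<Rightarrow> real" where
  "box_bump a b n x =
     (\<Prod>i\<in>Basis. flat_exp 1 (x \<bullet> (real (Suc n) *\<^sub>R i) - real (Suc n) * (a \<bullet> i)) *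
        flat_exp 1 (x \<bullet> (- real (Suc n) *\<^sub>R i) - (- real (Suc n) * (b \<bullet> i))))"

lemma flat_exp_1_scaled:
  "flat_exp 1 (real (Suc n) * s) = (if s \<le> 0 then 0 else exp (- (1 / s) / real (Suc n)))"
proof -
  have "real (Suc n) * s \<le> 0 \<longleftrightarrow> s \<le> 0"
    by (simp add: mult_le_0_iff del: of_nat_Suc)
  then show ?thesis by (simp add: flat_exp_def field_simps del: of_nat_Suc)
qed

lemma box_bump_altdef:
  "box_bump a b n x =
     (\<Prod>i\<in>Basis. flat_exp 1 (real (Suc n) * (x \<bullet> i - a \<bullet> i)) * flat_exp 1 (real (Suc n) * (b \<bullet> i - x \<bullet> i)))"
  unfolding box_bump_def by (simp only: inner_scaleR_right right_diff_distrib mult_minus_left minus_diff_minus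
      diff_minus_eq_add add.commute[of "- _"] diff_conv_add_uminus[symmetric])

lemma flat_exp_1_bounds: "0 \<le> flat_exp 1 t" "flat_exp 1 t \<le> 1"
  by (auto simp: flat_exp_def)

lemma box_bump_eq_0:
  assumes "x \<notin> box a b"
  shows "box_bump a b n x = 0"
proof -
  obtain i where i: "i \<in> Basis" "x \<bullet> i - a \<bullet> i \<le> 0 \<or> b \<bullet> i - x \<bullet> i \<le> 0"
    using assms by (force simp: mem_box not_less)
  then have "flat_exp 1 (real (Suc n) * (x \<bullet> i - a \<bullet> i)) * flat_exp 1 (real (Suc n) * (b \<bullet> i - x \<bullet> i)) = 0"
    unfolding flat_exp_1_scaled by auto
  with i(1) show ?thesis
    unfolding box_bump_altdef by (intro prod_zero) auto
qed

lemma abs_box_bump_le_1: "\<bar>box_bump a b n x\<bar> \<le> 1"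
  unfolding box_bump_altdef abs_prod
  by (intro prod_le_1 conjI abs_ge_zero) (simp only: abs_mult abs_of_nonneg flat_exp_1_bounds mult_le_one)

lemma box_bump_tendsto: "(\<lambda>n. box_bump a b n x) \<longlonglongrightarrow> indicator (box a b) x"
proof (cases "x \<in> box a b")
  case True
  have *: "(\<lambda>n. flat_exp 1 (real (Suc n) * s)) \<longlonglongrightarrow> 1" if "s > 0" for s
  proof -
    have "(\<lambda>n. - (1 / s) / real (Suc n)) \<longlonglongrightarrow> 0"
      using tendsto_mult_right_zero[OF LIMSEQ_inverse_real_of_nat, of "-(1/s)"] by (simp add: divide_inverse)
    from tendsto_exp[OF this] show ?thesis
      unfolding flat_exp_1_scaled using that by simp
  qed
  have "(\<lambda>n. box_bump a b n x) \<longlonglongrightarrow> (\<Prod>i\<in>(Basis::'a set). 1 * 1)"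
    unfolding box_bump_altdef using True
    by (intro tendsto_prod tendsto_mult *) (auto simp: mem_box)
  then show ?thesis using True by simp
qed (simp add: box_bump_eq_0)

lemma times_differentiable_box_bump: "times_differentiable k (box_bump a b n)"
  unfolding box_bump_def[abs_def]
  by (intro times_differentiable_prod times_differentiable_mult times_differentiable_flat_exp)

lemma box_bump_test_function:
  assumes "cbox a b \<subseteq> \<Omega>"
  shows "box_bump a b n \<in> test_functions \<Omega>"
proof -
  have "{x. box_bump a b n x \<noteq> 0} \<subseteq> cbox a b"
    using box_bump_eq_0 box_subset_cbox by blast
  then have "closure {x. box_bump a b n x \<noteq> 0} \<subseteq> cbox a b"
    by (intro closure_minimal closed_cbox)
  moreover from this have "compact (closure {x. box_bump a b n x \<noteq> 0})"
    by (meson bounded_cbox bounded_subset closed_closure compact_eq_bounded_closed)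
  ultimately show ?thesis
    using times_differentiable_box_bump assms unfolding test_functions_def by blast
qed

text \<open>
  The positive and the negative part of \<open>h\<close> are densities of finite measures that agree on the
  intersection-stable generator of all open boxes.
\<close>
lemma AE_eq_0_if_box_integrals_0:
  fixes h :: "'a::euclidean_space \<Rightarrow> real"
  assumes h: "integrable lborel h"
    and 0: "\<And>a b. (\<integral>x. indicator (box a b) x * h x \<partial>lborel) = 0"
  shows "AE x in lborel. h x = 0"
proof -
  have [measurable]: "h \<in> borel_measurable borel"
    using h by auto
  let ?M = "\<lambda>f. density lborel (\<lambda>x::'a. ennreal (f x))"
  have int: "integrable lborel (\<lambda>x. indicator (box a b) x * max 0 (f x))"
    if f: "integrable lborel f" for f :: "'a \<Rightarrow> real" and a b
  proof (rule Bochner_Integration.integrable_bound[OF f])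
    show "(\<lambda>x. indicator (box a b) x * max 0 (f x)) \<in> borel_measurable lborel"
      using borel_measurable_integrable[OF f] by measurable
  qed (auto simp: indicator_def)
  have em: "emeasure (?M (\<lambda>x. max 0 (f x))) (box a b) =
      ennreal (\<integral>x. indicator (box a b) x * max 0 (f x) \<partial>lborel)"
    if f: "integrable lborel f" for f :: "'a \<Rightarrow> real" and a b
  proof -
    have [measurable]: "f \<in> borel_measurable borel"
      using f by auto
    have "emeasure (?M (\<lambda>x. max 0 (f x))) (box a b) =
        (\<integral>\<^sup>+x. ennreal (max 0 (f x)) * indicator (box a b) x \<partial>lborel)"
      by (rule emeasure_density) auto
    also have "\<dots> = (\<integral>\<^sup>+x. ennreal (indicator (box a b) x * max 0 (f x)) \<partial>lborel)"
      by (intro nn_integral_cong) (simp add: indicator_def)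
    also have "\<dots> = ennreal (\<integral>x. indicator (box a b) x * max 0 (f x) \<partial>lborel)"
      by (intro nn_integral_eq_integral int f AE_I2) simp
    finally show ?thesis .
  qed
  have eq: "emeasure (?M (\<lambda>x. max 0 (h x))) (box a b) = emeasure (?M (\<lambda>x. max 0 (- h x))) (box a b)"
    for a b
  proof -
    have "(\<integral>x. indicator (box a b) x * max 0 (h x) \<partial>lborel) - (\<integral>x. indicator (box a b) x * max 0 (- h x) \<partial>lborel)
      = (\<integral>x. indicator (box a b) x * max 0 (h x) - indicator (box a b) x * max 0 (- h x) \<partial>lborel)"
      using h by (intro Bochner_Integration.integral_diff[symmetric] int) auto
    also have "\<dots> = (\<integral>x. indicator (box a b) x * h x \<partial>lborel)"
      by (intro Bochner_Integration.integral_cong) (auto simp: indicator_def max_def)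
    finally show ?thesis
      unfolding em[OF h] em[OF Bochner_Integration.integrable_minus[OF h]] using 0[of a b] by simp
  qed
  have "?M (\<lambda>x. max 0 (h x)) = ?M (\<lambda>x. max 0 (- h x))"
  proof (rule measure_eqI_generator_eq)
    let ?E = "range (\<lambda>(a, b). box a b::'a set)"
    show "Int_stable ?E"
      by (auto simp: Int_stable_def box_Int_box)
    show "?E \<subseteq> Pow UNIV" "sets (?M (\<lambda>x. max 0 (h x))) = sigma_sets UNIV ?E"
      "sets (?M (\<lambda>x. max 0 (- h x))) = sigma_sets UNIV ?E"
      by (simp_all add: borel_eq_box)
    let ?A = "\<lambda>n::nat. box (- (real n *\<^sub>R One)) (real n *\<^sub>R One) :: 'a set"
    show "range ?A \<subseteq> ?E" "(\<Union>i. ?A i) = UNIV"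
      unfolding UN_box_eq_UNIV by auto
    show "emeasure (?M (\<lambda>x. max 0 (h x))) (?A i) \<noteq> \<infinity>" for i
      by (subst em[OF h]) simp
    show "emeasure (?M (\<lambda>x. max 0 (h x))) X = emeasure (?M (\<lambda>x. max 0 (- h x))) X" if "X \<in> ?E" for X
      using that eq by auto
  qed
  then have "AE x in lborel. ennreal (max 0 (h x)) = ennreal (max 0 (- h x))"
    by (intro sigma_finite_measure.density_unique[OF sigma_finite_lborel]) auto
  then show ?thesis
    by eventually_elim (auto simp: max_def split: if_splits)
qed

lemma fundamental_lemma_calculus_of_variations:
  fixes h :: "'a::euclidean_space \<Rightarrow> real"
  assumes "open \<Omega>" and h: "integrable lborel h"
    and test: "\<And>\<psi>. \<psi> \<in> test_functions \<Omega> \<Longrightarrow> (\<integral>x. h x * \<psi> x \<partial>lborel) = 0"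
  shows "AE x in lborel. x \<in> \<Omega> \<longrightarrow> h x = 0"
proof -
  have [measurable]: "h \<in> borel_measurable borel"
    using h by auto
  have box0: "(\<integral>x. indicator (box a b) x * h x \<partial>lborel) = 0" if "cbox a b \<subseteq> \<Omega>" for a b
  proof -
    have bump[measurable]: "box_bump a b n \<in> borel_measurable borel" for n
      by (rule borel_measurable_continuous_onI[OF times_differentiable_continuous[OF times_differentiable_box_bump]])
    have "(\<lambda>n. \<integral>x. box_bump a b n x * h x \<partial>lborel) \<longlonglongrightarrow> (\<integral>x. indicator (box a b) x * h x \<partial>lborel)"
    proof (rule integral_dominated_convergence[where w = "\<lambda>x. \<bar>h x\<bar>"])
      show "AE x in lborel. (\<lambda>n. box_bump a b n x * h x) \<longlonglongrightarrow> indicator (box a b) x * h x"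
        by (intro AE_I2 tendsto_mult box_bump_tendsto tendsto_const)
      show "AE x in lborel. norm (box_bump a b n x * h x) \<le> \<bar>h x\<bar>" for n
        by (intro AE_I2) (simp add: abs_mult mult_left_le_one_le abs_box_bump_le_1)
    qed (use h in simp_all)
    moreover have "(\<integral>x. box_bump a b n x * h x \<partial>lborel) = 0" for n
      using test[OF box_bump_test_function[OF that]] by (simp add: mult.commute)
    ultimately show ?thesis
      by (simp add: LIMSEQ_const_iff)
  qed
  have zero: "AE x in lborel. x \<in> box a b \<longrightarrow> h x = 0" if ab: "cbox a b \<subseteq> \<Omega>" for a b
  proof -
    \<comment> \<open>Intersecting an arbitrary box with \<open>box a b\<close> gives a box that is again inside \<open>\<Omega>\<close>.\<close>
    have "AE x in lborel. indicator (box a b) x * h x = 0"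
    proof (rule AE_eq_0_if_box_integrals_0)
      show "integrable lborel (\<lambda>x. indicator (box a b) x * h x)"
        by (intro Bochner_Integration.integrable_bound[OF h]) (auto simp: indicator_def)
      fix c d
      obtain p q where pq: "box c d \<inter> box a b = box p q"
        using box_Int_box by blast
      have "(\<integral>x. indicator (box p q) x * h x \<partial>lborel) = 0"
      proof (cases "box p q = {}")
        case False
        have "closure (box p q) \<subseteq> closure (box a b)"
          using pq by (intro closure_mono) blast
        moreover have "closure (box a b) \<subseteq> cbox a b"
          by (intro closure_minimal closed_cbox box_subset_cbox)
        ultimately have "cbox p q \<subseteq> \<Omega>"
          using ab closure_box[OF False] by blast
        then show ?thesis by (rule box0)
      qed simp
      then show "(\<integral>x. indicator (box c d) x * (indicator (box a b) x * h x) \<partial>lborel) = 0"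
        by (simp add: pq[symmetric] indicator_inter_arith mult.assoc)
    qed
    then show ?thesis by eventually_elim (auto simp: indicator_def split: if_splits)
  qed
  \<comment> \<open>The countable cover consists of closed boxes, which differ from the open ones by null sets.\<close>
  obtain D where D: "countable D" "D \<subseteq> Pow \<Omega>" "\<And>X. X \<in> D \<Longrightarrow> \<exists>a b. X = cbox a b" "\<Union>D = \<Omega>"
    using open_countable_Union_open_cbox[OF \<open>open \<Omega>\<close>] by metis
  have "AE x in lborel. \<forall>X\<in>D. x \<in> X \<longrightarrow> h x = 0"
  proof (rule AE_ball_countable'[OF _ D(1)])
    fix X assume "X \<in> D"
    then obtain a b where ab: "X = cbox a b" "cbox a b \<subseteq> \<Omega>" using D by blast
    have "AE x in lborel. x \<notin> cbox a b - box a b"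
    proof (rule AE_not_in)
      have "cbox a b - box a b \<in> sets lborel" by simp
      moreover have "negligible (cbox a b - box a b)"
        by (rule negligible_frontier_interval)
      ultimately show "cbox a b - box a b \<in> null_sets lborel"
        using negligible_iff_null_sets null_sets_completion_iff by blast
    qed
    with zero[OF ab(2)] show "AE x in lborel. x \<in> X \<longrightarrow> h x = 0"
      by eventually_elim (auto simp: ab)
  qed
  then show ?thesis by eventually_elim (use D(4) in blast)
qed

section \<open>Integration along rays\<close>

text \<open>
  The integral of \<open>p\<close> over the segment from \<open>x\<close> to \<open>x + d *\<^sub>R e\<close>, parametrised by \<open>t \<in> {0..d}\<close>. It is
  \<open>0\<close> by convention where \<open>p\<close> is not integrable along the segment; for integrable \<open>p\<close> this is a null
  set of points \<open>x\<close>.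
\<close>
definition ray_integral :: "real \<Rightarrow> 'a::euclidean_space \<Rightarrow> ('a \<Rightarrow> real) \<Rightarrow> 'a \<Rightarrow> real" where
  "ray_integral d e p x = (\<integral>t. indicator {0..d} t * p (x + t *\<^sub>R e) \<partial>lborel)"

lemma lborel_integral_translate:
  fixes f :: "'a::euclidean_space \<Rightarrow> real"
  assumes [measurable]: "f \<in> borel_measurable borel"
  shows "(\<integral>x. f (x + c) \<partial>lborel) = (\<integral>x. f x \<partial>lborel)"
proof -
  have "(\<integral>x. f x \<partial>lborel) = (\<integral>x. f x \<partial>distr lborel borel ((+) c))"
    by (simp add: lborel_distr_plus)
  also have "\<dots> = (\<integral>x. f (c + x) \<partial>lborel)"
    by (subst integral_distr) auto
  finally show ?thesis by (simp add: add.commute)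
qed

lemma lborel_nn_integral_translate:
  fixes f :: "'a::euclidean_space \<Rightarrow> ennreal"
  assumes [measurable]: "f \<in> borel_measurable borel"
  shows "(\<integral>\<^sup>+x. f (x + c) \<partial>lborel) = (\<integral>\<^sup>+x. f x \<partial>lborel)"
proof -
  have "(\<integral>\<^sup>+x. f x \<partial>lborel) = (\<integral>\<^sup>+x. f x \<partial>distr lborel borel ((+) c))"
    by (simp add: lborel_distr_plus)
  also have "\<dots> = (\<integral>\<^sup>+x. f (c + x) \<partial>lborel)"
    by (subst nn_integral_distr) auto
  finally show ?thesis by (simp add: add.commute)
qed

lemma lborel_integrable_translate:
  fixes f :: "'a::euclidean_space \<Rightarrow> real"
  assumes "integrable lborel f"
  shows "integrable lborel (\<lambda>x. f (x + c))"
proof -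
  have [measurable]: "f \<in> borel_measurable borel"
    using assms by auto
  have "integrable (distr lborel borel ((+) c)) f"
    using assms by (simp add: lborel_distr_plus)
  then show ?thesis
    by (subst (asm) integrable_distr_eq) (auto simp: add.commute)
qed

lemma integrable_ray_product:
  fixes p :: "'a::euclidean_space \<Rightarrow> real"
  assumes p: "integrable lborel p"
  shows "integrable (lborel \<Otimes>\<^sub>M lborel) (\<lambda>(t, x). indicator {0..d} t * p (x + t *\<^sub>R e))"
proof (rule lborel_pair.Fubini_integrable)
  have [measurable]: "p \<in> borel_measurable borel"
    using p by auto
  show "(\<lambda>(t, x). indicator {0..d} t * p (x + t *\<^sub>R e)) \<in> borel_measurable (lborel \<Otimes>\<^sub>M lborel)"
    by measurable
  have "(\<integral>x. norm (indicator {0..d} t * p (x + t *\<^sub>R e)) \<partial>lborel) = indicator {0..d} t * (\<integral>x. \<bar>p x\<bar> \<partial>lborel)" for t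
    using lborel_integral_translate[of "\<lambda>x. \<bar>p x\<bar>" "t *\<^sub>R e"] by (simp add: abs_mult)
  moreover have "integrable lborel (indicator {0..d} :: real \<Rightarrow> real)"
    by (rule integrable_real_indicator) (auto simp: emeasure_lborel_Icc_eq)
  ultimately show "integrable lborel (\<lambda>t. \<integral>x. norm (case (t, x) of (t, x) \<Rightarrow> indicator {0..d} t * p (x + t *\<^sub>R e)) \<partial>lborel)"
    by simp
  show "AE t in lborel. integrable lborel (\<lambda>x. case (t, x) of (t, x) \<Rightarrow> indicator {0..d} t * p (x + t *\<^sub>R e))"
    using lborel_integrable_translate[OF p] by simp
qed

lemma ray_integral_measurable [measurable]:
  fixes p :: "'a::euclidean_space \<Rightarrow> real"
  assumes [measurable]: "p \<in> borel_measurable borel"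
  shows "ray_integral d e p \<in> borel_measurable borel"
  unfolding ray_integral_def[abs_def] by measurable

lemma integrable_ray_integral:
  assumes "integrable lborel p"
  shows "integrable lborel (ray_integral d e p)"
  using lborel_pair.integrable_snd[OF integrable_ray_product[OF assms, of d e, unfolded]]
  unfolding ray_integral_def[abs_def] by simp

lemma abs_ray_integral_le:
  assumes w: "\<And>x. \<bar>w x\<bar> \<le> 1" and d: "0 \<le> d"
  shows "\<bar>ray_integral d e w x\<bar> \<le> d"
proof (cases "integrable lborel (\<lambda>t. indicator {0..d} t * w (x + t *\<^sub>R e))")
  case True
  have "integrable lborel (indicator {0..d} :: real \<Rightarrow> real)"
    by (rule integrable_real_indicator) (auto simp: emeasure_lborel_Icc_eq)
  moreover have "\<bar>indicator {0..d} t * w (x + t *\<^sub>R e)\<bar> \<le> indicator {0..d} t" for t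
    using w by (simp add: indicator_def)
  ultimately have "\<bar>ray_integral d e w x\<bar> \<le> (\<integral>t. indicator {0..d} t \<partial>lborel)"
    unfolding ray_integral_def
    by (intro order_trans[OF integral_abs_bound] integral_mono integrable_abs True)
  then show ?thesis using d by simp
qed (use assms in \<open>simp add: ray_integral_def not_integrable_integral_eq\<close>)

text \<open>Integration along rays in direction \<open>e\<close> and in direction \<open>- e\<close> are adjoint to each other.\<close>
lemma ray_integral_adjoint:
  fixes p w :: "'a::euclidean_space \<Rightarrow> real"
  assumes p: "integrable lborel p" and w[measurable]: "w \<in> borel_measurable borel" and w1: "\<And>x. \<bar>w x\<bar> \<le> 1"
  shows "(\<integral>y. p y * ray_integral d (- e) w y \<partial>lborel) = (\<integral>x. w x * ray_integral d e p x \<partial>lborel)"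
proof -
  have [measurable]: "p \<in> borel_measurable borel"
    using p by auto
  define F where "F t y = indicator {0..d} t * (p y * w (y - t *\<^sub>R e))" for t y
  define G where "G t x = indicator {0..d} t * (p (x + t *\<^sub>R e) * w x)" for t x
  have le: "indicator {0..d} t * (\<bar>b\<bar> * \<bar>w z\<bar>) \<le> indicator {0..d} t * \<bar>b\<bar>" for t :: real and b z
    using w1[of z] by (simp add: mult_left_mono mult_left_le)
  have F: "integrable (lborel \<Otimes>\<^sub>M lborel) (case_prod F)"
    using integrable_ray_product[OF p, of d 0]
    by (rule Bochner_Integration.integrable_bound) (auto simp: F_def split_beta' abs_mult le)
  have G: "integrable (lborel \<Otimes>\<^sub>M lborel) (case_prod G)"
    using integrable_ray_product[OF p, of d e]
    by (rule Bochner_Integration.integrable_bound) (auto simp: G_def split_beta' abs_mult le)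
  have "(\<integral>y. p y * ray_integral d (- e) w y \<partial>lborel) = (\<integral>y. (\<integral>t. F t y \<partial>lborel) \<partial>lborel)"
    unfolding ray_integral_def F_def
    by (simp add: mult.left_commute[of "indicator _ _"])
  also have "\<dots> = (\<integral>t. (\<integral>y. F t y \<partial>lborel) \<partial>lborel)"
    by (rule lborel_pair.Fubini_integral[OF F])
  also have "\<dots> = (\<integral>t. (\<integral>x. G t x \<partial>lborel) \<partial>lborel)"
  proof (rule Bochner_Integration.integral_cong[OF refl])
    fix t :: real
    have "F t \<in> borel_measurable borel"
      unfolding F_def[abs_def] by measurable
    from lborel_integral_translate[OF this, of "t *\<^sub>R e"]
    show "(\<integral>y. F t y \<partial>lborel) = (\<integral>x. G t x \<partial>lborel)"
      by (auto simp: F_def G_def)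
  qed
  also have "\<dots> = (\<integral>x. (\<integral>t. G t x \<partial>lborel) \<partial>lborel)"
    by (rule lborel_pair.Fubini_integral[OF G, symmetric])
  also have "\<dots> = (\<integral>x. w x * ray_integral d e p x \<partial>lborel)"
    unfolding ray_integral_def G_def
    by (simp add: mult.left_commute[of "indicator _ _"] mult.commute[of _ "w _"])
  finally show ?thesis .
qed

lemma ray_integral_derivative:
  fixes f :: "'a::euclidean_space \<Rightarrow> real"
  assumes f: "times_differentiable 1 f" and d: "0 \<le> d"
  shows "ray_integral d e (\<lambda>x. frechet_derivative f (at x) e) x = f (x + d *\<^sub>R e) - f x"
proof -
  let ?D = "\<lambda>t. frechet_derivative f (at (x + t *\<^sub>R e)) e"
  have cont: "continuous_on UNIV (\<lambda>x. frechet_derivative f (at x) e)" and diff: "f differentiable at y" for y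
    using f by auto
  have "(\<integral>t. indicator {0..d} t *\<^sub>R ?D t \<partial>lborel) = f (x + d *\<^sub>R e) - f (x + 0 *\<^sub>R e)"
  proof (rule integral_FTC_atLeastAtMost[OF d])
    show "continuous_on {0..d} ?D"
      by (rule continuous_on_compose2[OF cont]) (auto intro!: continuous_intros)
    fix t
    have "((\<lambda>t. x + t *\<^sub>R e) has_derivative (\<lambda>h. h *\<^sub>R e)) (at t within {0..d})"
      by (auto intro!: derivative_eq_intros)
    from has_derivative_compose[OF this frechet_derivative_works_at[OF diff]]
    have "((\<lambda>t. f (x + t *\<^sub>R e)) has_derivative
        (\<lambda>h. frechet_derivative f (at (x + t *\<^sub>R e)) (h *\<^sub>R e))) (at t within {0..d})" .
    then show "((\<lambda>t. f (x + t *\<^sub>R e)) has_vector_derivative ?D t) (at t within {0..d})"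
      unfolding has_vector_derivative_def
      using linear_frechet_derivative[OF diff] by (simp add: linear_cmul)
  qed
  then show ?thesis by (simp add: ray_integral_def)
qed

section \<open>Test functions\<close>

lemma test_function_times_differentiable:
  "\<phi> \<in> test_functions \<Omega> \<Longrightarrow> times_differentiable n \<phi>"
  by (simp add: test_functions_def)

lemma test_function_compact_support:
  "\<phi> \<in> test_functions \<Omega> \<Longrightarrow> compact (closure {x. \<phi> x \<noteq> 0})"
  by (simp add: test_functions_def)

lemma test_function_eq_0: "\<phi> \<in> test_functions \<Omega> \<Longrightarrow> x \<notin> \<Omega> \<Longrightarrow> \<phi> x = 0"
  using closure_subset[of "{x. \<phi> x \<noteq> 0}"] by (auto simp: test_functions_def)

lemma test_function_continuous: "\<phi> \<in> test_functions \<Omega> \<Longrightarrow> continuous_on UNIV \<phi>"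
  by (rule times_differentiable_continuous[OF test_function_times_differentiable])

lemma test_function_differentiable: "\<phi> \<in> test_functions \<Omega> \<Longrightarrow> \<phi> differentiable at x"
  using test_function_times_differentiable[of \<phi> \<Omega> 1] by simp

lemma test_function_derivative_continuous:
  "\<phi> \<in> test_functions \<Omega> \<Longrightarrow> continuous_on UNIV (\<lambda>x. frechet_derivative \<phi> (at x) e)"
  using test_function_times_differentiable[of \<phi> \<Omega> 1] by simp

lemma continuous_compact_support_integrable:
  fixes f :: "'a::euclidean_space \<Rightarrow> real"
  assumes f: "continuous_on UNIV f" and K: "compact K" "\<And>x. x \<notin> K \<Longrightarrow> f x = 0"
  shows "integrable lborel f"
proof -
  have "integrable lborel (\<lambda>x. indicator K x *\<^sub>R f x)"
    using f K(1) by (intro borel_integrable_compact) (auto intro: continuous_on_subset)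
  moreover have "(\<lambda>x. indicator K x *\<^sub>R f x) = f"
    using K(2) by (auto simp: indicator_def fun_eq_iff)
  ultimately show ?thesis by simp
qed

lemma test_function_integrable:
  assumes "\<phi> \<in> test_functions \<Omega>"
  shows "integrable lborel \<phi>"
  by (rule continuous_compact_support_integrable[OF test_function_continuous[OF assms]
        test_function_compact_support[OF assms]]) (use closure_subset[of "{x. \<phi> x \<noteq> 0}"] in blast)

lemma test_function_bounded:
  assumes "\<phi> \<in> test_functions \<Omega>"
  shows "\<exists>C. \<forall>x. \<bar>\<phi> x\<bar> \<le> C"
proof -
  let ?K = "closure {x. \<phi> x \<noteq> 0}"
  have "compact (\<phi> ` ?K)"
    by (intro compact_continuous_image continuous_on_subset[OF test_function_continuous[OF assms]]
        test_function_compact_support[OF assms]) simp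
  then obtain C where "\<And>x. x \<in> ?K \<Longrightarrow> \<bar>\<phi> x\<bar> \<le> C"
    using compact_imp_bounded bounded_iff by (metis image_eqI real_norm_def)
  then have "\<bar>\<phi> x\<bar> \<le> \<bar>C\<bar>" for x
    using closure_subset[of "{x. \<phi> x \<noteq> 0}"] by (cases "\<phi> x = 0") force+
  then show ?thesis by blast
qed

lemma frechet_derivative_eq_0_off_support:
  fixes f :: "'a::euclidean_space \<Rightarrow> real"
  assumes "x \<notin> closure {x. f x \<noteq> 0}"
  shows "frechet_derivative f (at x) e = 0"
proof -
  have "((\<lambda>_. 0) has_derivative (\<lambda>_. 0)) (at x)" by simp
  then have "(f has_derivative (\<lambda>_. 0)) (at x)"
    by (rule has_derivative_transform_within_open[where s = "- closure {x. f x \<noteq> 0}"])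
      (use assms closure_subset[of "{x. f x \<noteq> 0}"] in auto)
  then show ?thesis by (simp add: frechet_derivative_eqI)
qed

lemma test_function_derivative_integrable:
  assumes "\<phi> \<in> test_functions \<Omega>"
  shows "integrable lborel (\<lambda>x. frechet_derivative \<phi> (at x) e)"
  by (rule continuous_compact_support_integrable[OF test_function_derivative_continuous[OF assms]
        test_function_compact_support[OF assms]]) (rule frechet_derivative_eq_0_off_support)

lemma test_function_mult:
  assumes \<phi>: "\<phi> \<in> test_functions \<Omega>" and \<psi>: "\<psi> \<in> test_functions \<Omega>"
  shows "(\<lambda>x. \<phi> x * \<psi> x) \<in> test_functions \<Omega>"
proof -
  have sub: "closure {x. \<phi> x * \<psi> x \<noteq> 0} \<subseteq> closure {x. \<phi> x \<noteq> 0}"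
    by (rule closure_mono) auto
  then have "closure {x. \<phi> x * \<psi> x \<noteq> 0} = closure {x. \<phi> x \<noteq> 0} \<inter> closure {x. \<phi> x * \<psi> x \<noteq> 0}"
    by blast
  then have "compact (closure {x. \<phi> x * \<psi> x \<noteq> 0})"
    using compact_Int_closed[OF test_function_compact_support[OF \<phi>] closed_closure[of "{x. \<phi> x * \<psi> x \<noteq> 0}"]] by argo
  moreover have "times_differentiable n (\<lambda>x. \<phi> x * \<psi> x)" for n
    using \<phi> \<psi> by (intro times_differentiable_mult test_function_times_differentiable)
  moreover have "closure {x. \<phi> x \<noteq> 0} \<subseteq> \<Omega>"
    using \<phi> by (simp add: test_functions_def)
  ultimately show ?thesis
    using sub unfolding test_functions_def by blast
qed

text \<open>
  Averaging \<open>\<phi> (x + e) - \<phi> x\<close>, whose integral vanishes by translation invariance, along the ray.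
\<close>
lemma test_function_integral_derivative:
  assumes \<phi>: "\<phi> \<in> test_functions \<Omega>"
  shows "(\<integral>x. frechet_derivative \<phi> (at x) e \<partial>lborel) = 0"
proof -
  note int = test_function_integrable[OF \<phi>]
  then have [measurable]: "\<phi> \<in> borel_measurable borel" by auto
  have "(\<integral>x. frechet_derivative \<phi> (at x) e \<partial>lborel) =
      (\<integral>x. frechet_derivative \<phi> (at x) e * ray_integral 1 (- e) (\<lambda>_. 1) x \<partial>lborel)"
    by (simp add: ray_integral_def)
  also have "\<dots> = (\<integral>x. 1 * ray_integral 1 e (\<lambda>x. frechet_derivative \<phi> (at x) e) x \<partial>lborel)"
    by (rule ray_integral_adjoint) (auto intro: test_function_derivative_integrable[OF \<phi>])
  also have "\<dots> = (\<integral>x. \<phi> (x + e) - \<phi> x \<partial>lborel)"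
    by (subst ray_integral_derivative[OF test_function_times_differentiable[OF \<phi>]]) simp_all
  also have "\<dots> = 0"
    using int by (simp add: lborel_integrable_translate lborel_integral_translate)
  finally show ?thesis .
qed

lemma test_function_integration_by_parts:
  assumes \<phi>: "\<phi> \<in> test_functions \<Omega>" and \<psi>: "\<psi> \<in> test_functions \<Omega>"
  shows "(\<integral>x. \<phi> x * frechet_derivative \<psi> (at x) e \<partial>lborel) =
    - (\<integral>x. frechet_derivative \<phi> (at x) e * \<psi> x \<partial>lborel)"
proof -
  note diff = test_function_differentiable[OF \<phi>] test_function_differentiable[OF \<psi>]
  note cpt = test_function_compact_support[OF \<phi>]
  have 1: "integrable lborel (\<lambda>x. \<phi> x * frechet_derivative \<psi> (at x) e)"
  proof (rule continuous_compact_support_integrable[OF _ cpt])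
    show "continuous_on UNIV (\<lambda>x. \<phi> x * frechet_derivative \<psi> (at x) e)"
      by (intro continuous_on_mult test_function_continuous[OF \<phi>] test_function_derivative_continuous[OF \<psi>])
    show "\<phi> x * frechet_derivative \<psi> (at x) e = 0" if "x \<notin> closure {x. \<phi> x \<noteq> 0}" for x
      using that closure_subset[of "{x. \<phi> x \<noteq> 0}"] by auto
  qed
  have 2: "integrable lborel (\<lambda>x. frechet_derivative \<phi> (at x) e * \<psi> x)"
  proof (rule continuous_compact_support_integrable[OF _ cpt])
    show "continuous_on UNIV (\<lambda>x. frechet_derivative \<phi> (at x) e * \<psi> x)"
      by (intro continuous_on_mult test_function_continuous[OF \<psi>] test_function_derivative_continuous[OF \<phi>])
  qed (simp add: frechet_derivative_eq_0_off_support)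
  have "frechet_derivative (\<lambda>x. \<phi> x * \<psi> x) (at x) e =
      \<phi> x * frechet_derivative \<psi> (at x) e + frechet_derivative \<phi> (at x) e * \<psi> x" for x
    by (simp add: frechet_derivative_eqI[OF has_derivative_mult[OF diff[THEN frechet_derivative_works_at]]])
  then show ?thesis
    using test_function_integral_derivative[OF test_function_mult[OF \<phi> \<psi>], of e] 1 2 by simp
qed

section \<open>Borel representatives\<close>

lemma integral_lebesgue_on_open:
  fixes f :: "'a::euclidean_space \<Rightarrow> real"
  assumes "open \<Omega>" and [measurable]: "f \<in> borel_measurable borel" and 0: "\<And>x. x \<notin> \<Omega> \<Longrightarrow> f x = 0"
  shows "(LINT x|lebesgue_on \<Omega>. f x) = (\<integral>x. f x \<partial>lborel)"
proof -
  have "(LINT x|lebesgue_on \<Omega>. f x) = (LINT x|lebesgue. indicator \<Omega> x *\<^sub>R f x)"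
    using \<open>open \<Omega>\<close> by (intro integral_restrict_space) auto
  also have "(\<lambda>x. indicator \<Omega> x *\<^sub>R f x) = f"
    using 0 by (auto simp: indicator_def fun_eq_iff)
  finally show ?thesis by (simp add: integral_completion)
qed

lemma nn_integral_lebesgue_on_open:
  fixes f :: "'a::euclidean_space \<Rightarrow> ennreal"
  assumes "open \<Omega>"
  shows "(\<integral>\<^sup>+x. f x \<partial>lebesgue_on \<Omega>) = (\<integral>\<^sup>+x. f x * indicator \<Omega> x \<partial>lborel)"
  using assms by (subst nn_integral_restrict_space) (auto simp: nn_integral_completion)

text \<open>
  Fubini's theorem is used for \<open>lborel\<close>, since products of complete measures need not be complete.
  Functions on \<open>\<Omega>\<close> are therefore replaced by Borel functions on the whole space that vanish
  outside \<open>\<Omega>\<close>.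
\<close>
lemma lebesgue_on_borel_representative:
  fixes f :: "'a::euclidean_space \<Rightarrow> real"
  assumes "open \<Omega>" and f: "integrable (lebesgue_on \<Omega>) f"
  obtains p where "integrable lborel p" "\<And>x. x \<notin> \<Omega> \<Longrightarrow> p x = 0"
    "AE x in lborel. x \<in> \<Omega> \<longrightarrow> f x = p x"
    "\<And>k. k \<in> borel_measurable borel \<Longrightarrow> (LINT x|lebesgue_on \<Omega>. f x * k x) = (\<integral>x. p x * k x \<partial>lborel)"
proof -
  have [measurable]: "\<Omega> \<in> sets borel" using \<open>open \<Omega>\<close> by simp
  have \<Omega>: "\<Omega> \<inter> space lebesgue \<in> sets lebesgue" using \<open>open \<Omega>\<close> by auto
  let ?F = "\<lambda>x. indicator \<Omega> x *\<^sub>R f x"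
  have F: "integrable lebesgue ?F"
    using f integrable_restrict_space[OF \<Omega>] by blast
  then obtain g where g: "g \<in> borel_measurable lborel" "AE x in lborel. ?F x = g x"
    using completion_ex_borel_measurable_real[of ?F lborel] by auto
  define p where "p x = indicator \<Omega> x * g x" for x
  have p[measurable]: "p \<in> borel_measurable borel"
    using g(1) unfolding p_def[abs_def] by measurable
  have ae: "AE x in lborel. ?F x = p x"
    using g(2) by eventually_elim (auto simp: p_def indicator_def)
  have "integrable lebesgue p"
  proof (rule integrable_cong_AE_imp[OF F])
    show "p \<in> borel_measurable lebesgue"
      using p by (intro measurable_completion) simp
    show "AE x in lebesgue. ?F x = p x"
      by (rule AE_completion[OF ae])
  qed
  then have int: "integrable lborel p"
    using p by (simp add: integrable_completion)
  have "(LINT x|lebesgue_on \<Omega>. f x * k x) = (\<integral>x. p x * k x \<partial>lborel)"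
    if k[measurable]: "k \<in> borel_measurable borel" for k
  proof -
    have "(LINT x|lebesgue_on \<Omega>. f x * k x) = (LINT x|lebesgue. ?F x * k x)"
      by (subst integral_restrict_space[OF \<Omega>]) (simp add: mult.assoc)
    also have "\<dots> = (LINT x|lebesgue. p x * k x)"
    proof (rule integral_cong_AE)
      have [measurable]: "k \<in> borel_measurable lebesgue" "p \<in> borel_measurable lebesgue"
        using k p by (auto intro!: measurable_completion)
      note borel_measurable_integrable[OF F, measurable]
      show "(\<lambda>x. ?F x * k x) \<in> borel_measurable lebesgue" "(\<lambda>x. p x * k x) \<in> borel_measurable lebesgue"
        by (intro borel_measurable_times; measurable)+
      show "AE x in lebesgue. ?F x * k x = p x * k x"
        using AE_completion[OF ae] by eventually_elim simp
    qed
    also have "\<dots> = (\<integral>x. p x * k x \<partial>lborel)"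
      by (rule integral_completion) simp
    finally show ?thesis .
  qed
  moreover have "AE x in lborel. x \<in> \<Omega> \<longrightarrow> f x = p x"
    using ae by eventually_elim (auto simp: indicator_def)
  ultimately show thesis
    using that[of p] int by (simp add: p_def)
qed

section \<open>Weak gradients of test functions\<close>

text \<open>
  Any integrable weak gradient of a test function agrees with the classical gradient almost
  everywhere. This is recorded componentwise, in the integrated form in which it is used; \<open>k\<close> need
  be neither smooth nor supported in \<open>\<Omega>\<close>.
\<close>
lemma integral_weak_gradient_test_function:
  fixes \<phi> :: "'a::euclidean_space \<Rightarrow> real"
  assumes \<Omega>: "open \<Omega>" and \<phi>: "\<phi> \<in> test_functions \<Omega>" and g: "has_weak_gradient \<Omega> \<phi> g"
    and int: "integrable (lebesgue_on \<Omega>) g" and i: "i \<in> Basis" and k: "k \<in> borel_measurable borel"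
  shows "(LINT x|lebesgue_on \<Omega>. (g x \<bullet> i) * k x) = (\<integral>x. frechet_derivative \<phi> (at x) i * k x \<partial>lborel)"
proof -
  let ?D = "\<lambda>x. frechet_derivative \<phi> (at x) i"
  have gi: "integrable (lebesgue_on \<Omega>) (\<lambda>x. g x \<bullet> i)"
    using int by simp
  obtain p where p: "integrable lborel p" "\<And>x. x \<notin> \<Omega> \<Longrightarrow> p x = 0"
    and "AE x in lborel. x \<in> \<Omega> \<longrightarrow> g x \<bullet> i = p x"
    and pk: "\<And>k. k \<in> borel_measurable borel \<Longrightarrow> (LINT x|lebesgue_on \<Omega>. (g x \<bullet> i) * k x) = (\<integral>x. p x * k x \<partial>lborel)"
    by (rule lebesgue_on_borel_representative[OF \<Omega> gi]) (rule that)
  note D = test_function_derivative_integrable[OF \<phi>, of i]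
  have "AE x in lborel. x \<in> \<Omega> \<longrightarrow> p x - ?D x = 0"
  proof (rule fundamental_lemma_calculus_of_variations[OF \<Omega>])
    show "integrable lborel (\<lambda>x. p x - ?D x)"
      using p(1) D by simp
    fix \<psi> :: "'a \<Rightarrow> real" assume \<psi>: "\<psi> \<in> test_functions \<Omega>"
    have [measurable]: "\<psi> \<in> borel_measurable borel"
      using test_function_integrable[OF \<psi>] by auto
    have [measurable]: "\<phi> \<in> borel_measurable borel"
      using test_function_integrable[OF \<phi>] by auto
    have [measurable]: "(\<lambda>x. frechet_derivative \<psi> (at x) i) \<in> borel_measurable borel"
      using test_function_derivative_integrable[OF \<psi>] by auto
    obtain C where C: "\<And>x. \<bar>\<psi> x\<bar> \<le> C"
      using test_function_bounded[OF \<psi>] by blast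
    have prod: "integrable lborel (\<lambda>x. f x * \<psi> x)" if f: "integrable lborel f" for f
    proof (rule Bochner_Integration.integrable_bound)
      show "integrable lborel (\<lambda>x. C * f x)" using f by simp
      show "(\<lambda>x. f x * \<psi> x) \<in> borel_measurable lborel"
        using borel_measurable_integrable[OF f] by measurable
      show "AE x in lborel. norm (f x * \<psi> x) \<le> norm (C * f x)"
      proof (intro AE_I2)
        fix x
        have "\<bar>\<psi> x\<bar> \<le> \<bar>C\<bar>" using C[of x] by linarith
        from mult_left_mono[OF this abs_ge_zero[of "f x"]]
        show "norm (f x * \<psi> x) \<le> norm (C * f x)"
          by (simp add: abs_mult mult.commute)
      qed
    qed
    have "(\<integral>x. (p x - ?D x) * \<psi> x \<partial>lborel) = (\<integral>x. p x * \<psi> x \<partial>lborel) - (\<integral>x. ?D x * \<psi> x \<partial>lborel)"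
      unfolding left_diff_distrib by (intro Bochner_Integration.integral_diff prod p(1) D)
    also have "(\<integral>x. p x * \<psi> x \<partial>lborel) = (LINT x|lebesgue_on \<Omega>. (g x \<bullet> i) * \<psi> x)"
      by (simp add: pk)
    also have "\<dots> = - (LINT x|lebesgue_on \<Omega>. \<phi> x * frechet_derivative \<psi> (at x) i)"
    proof -
      have "\<forall>i\<in>Basis. (LINT x|lebesgue_on \<Omega>. \<phi> x * frechet_derivative \<psi> (at x) i) =
          - (LINT x|lebesgue_on \<Omega>. (g x \<bullet> i) * \<psi> x)"
        using g \<psi> unfolding has_weak_gradient_def by blast
      with i show ?thesis by simp
    qed
    also have "(LINT x|lebesgue_on \<Omega>. \<phi> x * frechet_derivative \<psi> (at x) i) = (\<integral>x. \<phi> x * frechet_derivative \<psi> (at x) i \<partial>lborel)"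
      by (rule integral_lebesgue_on_open[OF \<Omega>]) (simp_all add: test_function_eq_0[OF \<phi>])
    also have "- \<dots> = (\<integral>x. ?D x * \<psi> x \<partial>lborel)"
      by (simp add: test_function_integration_by_parts[OF \<phi> \<psi>])
    finally show "(\<integral>x. (p x - ?D x) * \<psi> x \<partial>lborel) = 0" by simp
  qed
  moreover have "?D x = 0" if "x \<notin> \<Omega>" for x
    using that \<phi> frechet_derivative_eq_0_off_support[of x \<phi> i] by (auto simp: test_functions_def)
  ultimately have ae: "AE x in lborel. p x * k x = ?D x * k x"
    using p(2) by (elim eventually_mono) force
  have "(LINT x|lebesgue_on \<Omega>. (g x \<bullet> i) * k x) = (\<integral>x. p x * k x \<partial>lborel)"
    by (rule pk[OF k])
  also have "\<dots> = (\<integral>x. ?D x * k x \<partial>lborel)"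
    using borel_measurable_integrable[OF p(1)] borel_measurable_integrable[OF D] k ae
    by (intro integral_cong_AE) (auto intro: borel_measurable_times)
  finally show ?thesis .
qed

text \<open>
  The dual form of \<open>\<phi> x = - \<integral>\<^sub>0\<^sup>d (\<nabla>\<phi> \<bullet> e) (x + t *\<^sub>R e) dt\<close>, which holds on \<open>\<Omega>\<close> because
  \<open>x + d *\<^sub>R e\<close> is outside \<open>\<Omega>\<close>.
\<close>
lemma test_function_ray_identity:
  fixes \<phi> :: "'a::euclidean_space \<Rightarrow> real"
  assumes \<Omega>: "open \<Omega>" and d: "0 \<le> d" "\<And>x. x \<in> \<Omega> \<Longrightarrow> x + d *\<^sub>R e \<notin> \<Omega>" and e: "e \<in> Basis"
    and \<phi>: "\<phi> \<in> test_functions \<Omega>" "\<phi> \<in> sobolev_W11 \<Omega>"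
    and w[measurable]: "w \<in> borel_measurable borel" and w1: "\<And>x. \<bar>w x\<bar> \<le> 1" and w0: "\<And>x. x \<notin> \<Omega> \<Longrightarrow> w x = 0"
  shows "(LINT x|lebesgue_on \<Omega>. \<phi> x * w x) +
    (LINT x|lebesgue_on \<Omega>. (weak_gradient \<Omega> \<phi> x \<bullet> e) * ray_integral d (- e) w x) = 0"
proof -
  let ?D = "\<lambda>x. frechet_derivative \<phi> (at x) e"
  have [measurable]: "\<phi> \<in> borel_measurable borel"
    using test_function_integrable[OF \<phi>(1)] by auto
  have g: "has_weak_gradient \<Omega> \<phi> (weak_gradient \<Omega> \<phi>)" "integrable (lebesgue_on \<Omega>) (weak_gradient \<Omega> \<phi>)"
    using \<phi>(2) someI_ex[of "has_weak_gradient \<Omega> \<phi>"] by (auto simp: sobolev_W11_def weak_gradient_def)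
  have "(LINT x|lebesgue_on \<Omega>. (weak_gradient \<Omega> \<phi> x \<bullet> e) * ray_integral d (- e) w x) =
      (\<integral>x. ?D x * ray_integral d (- e) w x \<partial>lborel)"
    by (rule integral_weak_gradient_test_function[OF \<Omega> \<phi>(1) g e]) simp
  also have "\<dots> = (\<integral>x. w x * ray_integral d e ?D x \<partial>lborel)"
    by (rule ray_integral_adjoint[OF test_function_derivative_integrable[OF \<phi>(1)] w w1])
  also have "\<dots> = (\<integral>x. - (\<phi> x * w x) \<partial>lborel)"
  proof (rule Bochner_Integration.integral_cong[OF refl])
    fix x
    have "ray_integral d e ?D x = \<phi> (x + d *\<^sub>R e) - \<phi> x"
      by (rule ray_integral_derivative[OF test_function_times_differentiable[OF \<phi>(1)] d(1)])
    then show "w x * ray_integral d e ?D x = - (\<phi> x * w x)"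
      using d(2)[of x] w0[of x] test_function_eq_0[OF \<phi>(1)] by (cases "x \<in> \<Omega>") auto
  qed
  also have "\<dots> = - (LINT x|lebesgue_on \<Omega>. \<phi> x * w x)"
    by (subst integral_lebesgue_on_open[OF \<Omega>]) (simp_all add: w0)
  finally show ?thesis by simp
qed

section \<open>Passing to the closure\<close>

lemma N_functionD:
  assumes "N_function B"
  shows "\<And>r. 0 \<le> r \<Longrightarrow> 0 \<le> B r" "\<And>r s. 0 \<le> r \<Longrightarrow> r \<le> s \<Longrightarrow> B r \<le> B s" "convex_on {0..} B" "B 0 = 0"
proof -
  show nonneg: "0 \<le> B r" if "0 \<le> r" for r
    using assms that by (simp add: N_function_def)
  show mono: "B r \<le> B s" if "0 \<le> r" "r \<le> s" for r s
    using assms that by (cases "r = s") (auto simp: N_function_def strict_mono_on_def less_imp_le)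
  show "convex_on {0..} B"
    using assms by (simp add: N_function_def)
  have "((\<lambda>r. B r / r * r) \<longlongrightarrow> 0 * 0) (at_right 0)"
    using assms by (intro tendsto_mult) (auto simp: N_function_def)
  then have "((\<lambda>r. B r / r * r) \<longlongrightarrow> 0) (at_right 0)" by simp
  moreover have "\<forall>\<^sub>F r in at_right 0. B 0 \<le> B r / r * r"
    by (auto simp: eventually_at_filter mono)
  ultimately have "B 0 \<le> 0"
    by (intro tendsto_lowerbound) auto
  with nonneg[of 0] show "B 0 = 0" by simp
qed

lemma conjugate_fun_bdd_above:
  assumes B: "N_function B" and s: "0 \<le> s"
  shows "bdd_above ((\<lambda>t. t * s - B t) ` {0<..})"
proof -
  have "\<forall>\<^sub>F t in at_top. s \<le> B t / t"
    using B by (auto simp: N_function_def filterlim_at_top)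
  then obtain T where T: "\<And>t. t \<ge> T \<Longrightarrow> s \<le> B t / t"
    by (auto simp: eventually_at_top_linorder)
  show ?thesis
  proof (rule bdd_aboveI2)
    fix t :: real assume "t \<in> {0<..}"
    then have t: "t > 0" by simp
    show "t * s - B t \<le> \<bar>T\<bar> * s"
    proof (cases "t \<ge> T")
      case True
      then have "t * s \<le> B t" using T[of t] t by (simp add: field_simps)
      then show ?thesis using s by (smt (verit) mult_nonneg_nonneg)
    next
      case False
      then have "t * s \<le> \<bar>T\<bar> * s" using s by (intro mult_right_mono) auto
      then show ?thesis using N_functionD(1)[OF B, of t] t by simp
    qed
  qed
qed

lemma conjugate_fun_mono:
  assumes B: "N_function B" and "0 \<le> r" "r \<le> s"
  shows "conjugate_fun B r \<le> conjugate_fun B s"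
  unfolding conjugate_fun_def
proof (rule cSUP_mono)
  show "bdd_above ((\<lambda>t. t * s - B t) ` {0<..})"
    using conjugate_fun_bdd_above[OF B] assms by simp
  show "\<exists>m\<in>{0<..}. t * r - B t \<le> m * s - B m" if "t \<in> {0<..}" for t
    using that assms(3) by (intro bexI[of _ t]) auto
qed auto

lemma conjugate_fun_0: "N_function B \<Longrightarrow> conjugate_fun B 0 \<le> 0"
  unfolding conjugate_fun_def by (rule cSUP_least) (auto simp: N_functionD(1))

text \<open>
  On a bounded open set bounded Borel functions belong to the \<open>E\<close>-space of the conjugate, because
  the conjugate is finite and monotone on \<open>{0..}\<close>.
\<close>
lemma bounded_in_orlicz_E:
  fixes \<eta> :: "'a::euclidean_space \<Rightarrow> 'b::euclidean_space"
  assumes B: "N_function B" and \<Omega>: "open \<Omega>" "bounded \<Omega>"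
    and \<eta>: "\<eta> \<in> borel_measurable borel" and M: "\<And>x. norm (\<eta> x) \<le> M"
  shows "\<eta> \<in> orlicz_E (conjugate_fun B) \<Omega>"
proof -
  let ?C = "conjugate_fun B"
  have "modular ?C \<Omega> \<eta> \<le> (\<integral>\<^sup>+x. ennreal (?C M) \<partial>lebesgue_on \<Omega>)"
    unfolding modular_def by (intro nn_integral_mono ennreal_leI conjugate_fun_mono[OF B] norm_ge_zero M)
  also have "\<dots> = ennreal (?C M) * emeasure lborel \<Omega>"
    using \<Omega>(1) by (subst nn_integral_lebesgue_on_open[OF \<Omega>(1)]) (simp add: nn_integral_cmult_indicator)
  also have "\<dots> < \<infinity>"
    using emeasure_bounded_finite[OF \<Omega>(2)] by (simp add: ennreal_mult_less_top)
  finally have "modular ?C \<Omega> \<eta> < \<infinity>" .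
  moreover have "\<eta> \<in> borel_measurable (lebesgue_on \<Omega>)"
    using \<eta> by (intro measurable_restrict_space1 measurable_completion) simp
  ultimately have "\<eta> \<in> orlicz_class ?C \<Omega>"
    by (simp add: orlicz_class_def)
  then have space: "\<eta> \<in> orlicz_space ?C \<Omega>"
    unfolding orlicz_space_def
    by (intro CollectI exI[of _ "1::nat"] exI[of _ "\<lambda>_. 1::real"] exI[of _ "\<lambda>_. \<eta>"]) simp
  have "modular ?C \<Omega> (\<lambda>x. (\<eta> x - \<eta> x) /\<^sub>R l) = 0" for l
    using conjugate_fun_0[OF B] by (simp add: modular_def ennreal_neg)
  then have "luxemburg_norm ?C \<Omega> (\<lambda>x. \<eta> x - \<eta> x) = 0"
    by (simp add: luxemburg_norm_def greaterThan_def[symmetric])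
  moreover have "bounded (\<eta> ` \<Omega>)"
    using M by (auto intro!: boundedI)
  ultimately show ?thesis
    using space by (auto simp: orlicz_E_def)
qed

lemma continuous_map_orlicz_pairing:
  assumes "\<eta> \<in> orlicz_E (conjugate_fun B) \<Omega>"
  shows "continuous_map (orlicz_weak_topology B \<Omega>) euclideanreal (\<lambda>\<xi>. LINT x|lebesgue_on \<Omega>. \<xi> x \<bullet> \<eta> x)"
proof -
  have "continuous_map (powertop_real (orlicz_E (conjugate_fun B) \<Omega>)) euclideanreal (\<lambda>p. p \<eta>)"
    using assms by (rule continuous_map_product_projection)
  from continuous_map_pullback[OF this, of "orlicz_space B \<Omega>"
      "\<lambda>\<xi>. \<lambda>\<eta>\<in>orlicz_E (conjugate_fun B) \<Omega>. LINT x|lebesgue_on \<Omega>. \<xi> x \<bullet> \<eta> x"]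
  show ?thesis
    using assms by (simp add: orlicz_weak_topology_def o_def)
qed

lemma orlicz_sobolev_0_subset: "orlicz_sobolev_0 B \<Omega> \<subseteq> orlicz_sobolev B \<Omega>"
proof -
  have "orlicz_sobolev_0 B \<Omega> \<subseteq> topspace (orlicz_sobolev_topology B \<Omega>)"
    unfolding orlicz_sobolev_0_def by (rule closure_of_subset_topspace)
  also have "\<dots> \<subseteq> orlicz_sobolev B \<Omega>"
    by (auto simp: orlicz_sobolev_topology_def topspace_pullback_topology)
  finally show ?thesis .
qed

text \<open>
  A continuous linear condition on \<open>u\<close> and its gradient that holds for all test functions in the
  space holds on the closure.
\<close>
lemma orlicz_sobolev_0_pairing_eq_0:
  fixes u :: "'a::euclidean_space \<Rightarrow> real"
  assumes u: "u \<in> orlicz_sobolev_0 B \<Omega>"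
    and w: "w \<in> orlicz_E (conjugate_fun B) \<Omega>" and \<eta>: "\<eta> \<in> orlicz_E (conjugate_fun B) \<Omega>"
    and test: "\<And>\<phi>. \<phi> \<in> test_functions \<Omega> \<Longrightarrow> \<phi> \<in> orlicz_sobolev B \<Omega> \<Longrightarrow>
      (LINT x|lebesgue_on \<Omega>. \<phi> x * w x) + (LINT x|lebesgue_on \<Omega>. weak_gradient \<Omega> \<phi> x \<bullet> \<eta> x) = 0"
  shows "(LINT x|lebesgue_on \<Omega>. u x * w x) + (LINT x|lebesgue_on \<Omega>. weak_gradient \<Omega> u x \<bullet> \<eta> x) = 0"
proof -
  let ?X = "orlicz_sobolev_topology B \<Omega>"
  let ?G = "\<lambda>(u :: 'a \<Rightarrow> real, g). (LINT x|lebesgue_on \<Omega>. u x \<bullet> w x) + (LINT x|lebesgue_on \<Omega>. g x \<bullet> \<eta> x)"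
  let ?F = "\<lambda>u. (LINT x|lebesgue_on \<Omega>. u x * w x) + (LINT x|lebesgue_on \<Omega>. weak_gradient \<Omega> u x \<bullet> \<eta> x)"
  let ?P = "prod_topology (orlicz_weak_topology B \<Omega>) (orlicz_weak_topology B \<Omega>)"
  have "continuous_map ?P euclideanreal ?G"
    unfolding case_prod_unfold
    by (intro continuous_map_add
        continuous_map_compose[OF continuous_map_fst continuous_map_orlicz_pairing[OF w], unfolded o_def]
        continuous_map_compose[OF continuous_map_snd continuous_map_orlicz_pairing[OF \<eta>], unfolded o_def])
  from continuous_map_pullback[OF this, of "orlicz_sobolev B \<Omega>" "\<lambda>u. (u, weak_gradient \<Omega> u)"]
  have F: "continuous_map ?X euclideanreal ?F"
    by (simp add: orlicz_sobolev_topology_def o_def)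
  have "topspace ?X \<subseteq> orlicz_sobolev B \<Omega>"
    by (auto simp: orlicz_sobolev_topology_def topspace_pullback_topology)
  then have img: "?F ` (topspace ?X \<inter> test_functions \<Omega>) \<subseteq> {0}"
    using test by blast
  have "u \<in> ?X closure_of (topspace ?X \<inter> test_functions \<Omega>)"
    using u closure_of_restrict unfolding orlicz_sobolev_0_def by metis
  then have "?F u \<in> euclideanreal closure_of (?F ` (topspace ?X \<inter> test_functions \<Omega>))"
    using continuous_map_image_closure_subset[OF F] by blast
  also have "\<dots> \<subseteq> euclideanreal closure_of {0}"
    by (rule closure_of_mono[OF img])
  finally show ?thesis by simp
qed

text \<open>
  Here \<open>p\<close> is a Borel representative of the \<open>e\<close>-component of the gradient, extended by zero.
\<close>
lemma orlicz_sobolev_0_ray_integral: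
  fixes u :: "'a::euclidean_space \<Rightarrow> real"
  assumes B: "N_function B" and \<Omega>: "open \<Omega>" "bounded \<Omega>"
    and d: "0 \<le> d" "\<And>x. x \<in> \<Omega> \<Longrightarrow> x + d *\<^sub>R e \<notin> \<Omega>" and e: "e \<in> Basis"
    and u: "u \<in> orlicz_sobolev_0 B \<Omega>"
  obtains p where "integrable lborel p" "\<And>x. x \<notin> \<Omega> \<Longrightarrow> p x = 0"
    "AE x in lborel. x \<in> \<Omega> \<longrightarrow> weak_gradient \<Omega> u x \<bullet> e = p x"
    "AE x in lborel. x \<in> \<Omega> \<longrightarrow> u x = - ray_integral d e p x"
proof -
  have W: "u \<in> sobolev_W11 \<Omega>"
    using u orlicz_sobolev_0_subset by (auto simp: orlicz_sobolev_def)
  then have ui: "integrable (lebesgue_on \<Omega>) u"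
    and gi: "integrable (lebesgue_on \<Omega>) (\<lambda>x. weak_gradient \<Omega> u x \<bullet> e)"
    by (simp_all add: sobolev_W11_def)
  obtain v where v: "integrable lborel v" "\<And>x. x \<notin> \<Omega> \<Longrightarrow> v x = 0" "AE x in lborel. x \<in> \<Omega> \<longrightarrow> u x = v x"
    "\<And>k. k \<in> borel_measurable borel \<Longrightarrow> (LINT x|lebesgue_on \<Omega>. u x * k x) = (\<integral>x. v x * k x \<partial>lborel)"
    by (rule lebesgue_on_borel_representative[OF \<Omega>(1) ui]) (rule that)
  obtain p where p: "integrable lborel p" "\<And>x. x \<notin> \<Omega> \<Longrightarrow> p x = 0"
    "AE x in lborel. x \<in> \<Omega> \<longrightarrow> weak_gradient \<Omega> u x \<bullet> e = p x"
    "\<And>k. k \<in> borel_measurable borel \<Longrightarrow>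
      (LINT x|lebesgue_on \<Omega>. (weak_gradient \<Omega> u x \<bullet> e) * k x) = (\<integral>x. p x * k x \<partial>lborel)"
    by (rule lebesgue_on_borel_representative[OF \<Omega>(1) gi]) (rule that)
  define q where "q x = v x + ray_integral d e p x" for x
  have q: "integrable lborel q"
    unfolding q_def[abs_def] by (intro Bochner_Integration.integrable_add v(1) integrable_ray_integral p(1))
  have [measurable]: "v \<in> borel_measurable borel" "p \<in> borel_measurable borel" "q \<in> borel_measurable borel"
    "\<Omega> \<in> sets borel"
    using v(1) p(1) q \<Omega>(1) by auto
  \<comment> \<open>Testing with the sign of \<open>q\<close> on \<open>\<Omega>\<close> turns the dual identity into \<open>\<integral>\<^sub>\<Omega> \<bar>q\<bar> = 0\<close>.\<close>
  define w where "w x = indicator \<Omega> x * (if q x > 0 then 1 else if q x < 0 then - 1 else 0 :: real)" for x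
  have w[measurable]: "w \<in> borel_measurable borel"
    unfolding w_def[abs_def] by measurable
  have w1: "\<bar>w x\<bar> \<le> 1" and w0: "x \<notin> \<Omega> \<Longrightarrow> w x = 0" for x
    by (auto simp: w_def indicator_def)
  have "(LINT x|lebesgue_on \<Omega>. u x * w x) +
    (LINT x|lebesgue_on \<Omega>. weak_gradient \<Omega> u x \<bullet> (ray_integral d (- e) w x *\<^sub>R e)) = 0"
  proof (rule orlicz_sobolev_0_pairing_eq_0[OF u])
    show "w \<in> orlicz_E (conjugate_fun B) \<Omega>"
      by (rule bounded_in_orlicz_E[OF B \<Omega> w, where M = 1]) (simp add: w1)
    show "(\<lambda>x. ray_integral d (- e) w x *\<^sub>R e) \<in> orlicz_E (conjugate_fun B) \<Omega>"
      by (rule bounded_in_orlicz_E[OF B \<Omega>, where M = d])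
        (use e in \<open>auto intro!: abs_ray_integral_le d w1\<close>)
    fix \<phi> assume "\<phi> \<in> test_functions \<Omega>" "\<phi> \<in> orlicz_sobolev B \<Omega>"
    then show "(LINT x|lebesgue_on \<Omega>. \<phi> x * w x) +
        (LINT x|lebesgue_on \<Omega>. weak_gradient \<Omega> \<phi> x \<bullet> (ray_integral d (- e) w x *\<^sub>R e)) = 0"
      using test_function_ray_identity[OF \<Omega>(1) d e _ _ w w1 w0, of \<phi>]
      by (simp add: orlicz_sobolev_def mult.commute)
  qed
  then have "0 = (\<integral>x. v x * w x \<partial>lborel) + (\<integral>x. p x * ray_integral d (- e) w x \<partial>lborel)"
    by (simp add: v(4) p(4) mult.commute[of "ray_integral _ _ _ _"])
  also have "(\<integral>x. p x * ray_integral d (- e) w x \<partial>lborel) = (\<integral>x. w x * ray_integral d e p x \<partial>lborel)"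
    by (rule ray_integral_adjoint[OF p(1) w w1])
  also have "(\<integral>x. v x * w x \<partial>lborel) + \<dots> = (\<integral>x. v x * w x + w x * ray_integral d e p x \<partial>lborel)"
  proof (rule Bochner_Integration.integral_add[symmetric])
    show "integrable lborel (\<lambda>x. v x * w x)"
      by (rule Bochner_Integration.integrable_bound[OF v(1)]) (auto simp: abs_mult w1 mult_left_le)
    show "integrable lborel (\<lambda>x. w x * ray_integral d e p x)"
      by (rule Bochner_Integration.integrable_bound[OF integrable_ray_integral[OF p(1), of d e]])
        (auto simp: abs_mult w1 mult_left_le_one_le)
  qed
  also have "\<dots> = (\<integral>x. indicator \<Omega> x * \<bar>q x\<bar> \<partial>lborel)"
  proof (rule Bochner_Integration.integral_cong[OF refl])
    fix x
    have "w x * q x = indicator \<Omega> x * \<bar>q x\<bar>"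
      by (simp add: w_def)
    then show "v x * w x + w x * ray_integral d e p x = indicator \<Omega> x * \<bar>q x\<bar>"
      by (simp add: q_def algebra_simps)
  qed
  finally have "(\<integral>x. indicator \<Omega> x * \<bar>q x\<bar> \<partial>lborel) = 0" by simp
  moreover have "integrable lborel (\<lambda>x. indicator \<Omega> x * \<bar>q x\<bar>)"
    by (rule Bochner_Integration.integrable_bound[OF q]) (auto simp: indicator_def)
  ultimately have "AE x in lborel. indicator \<Omega> x * \<bar>q x\<bar> = 0"
    by (subst (asm) integral_nonneg_eq_0_iff_AE) auto
  with v(3) have rep: "AE x in lborel. x \<in> \<Omega> \<longrightarrow> u x = - ray_integral d e p x"
    by eventually_elim (auto simp: q_def)
  show thesis by (rule that[OF p(1) p(2) p(3) rep])
qed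

section \<open>The modular Poincare inequality\<close>

lemma N_function_abs_measurable:
  assumes "N_function B"
  shows "(\<lambda>t. B \<bar>t\<bar>) \<in> borel_measurable borel"
proof -
  have "mono (\<lambda>t. B (max 0 t))"
    by (intro monoI N_functionD(2)[OF assms]) auto
  then have "(\<lambda>t. B (max 0 t)) \<in> borel_measurable borel"
    by (rule borel_measurable_mono)
  then have "(\<lambda>t. B (max 0 \<bar>t\<bar>)) \<in> borel_measurable borel"
    by measurable
  then show ?thesis by simp
qed

text \<open>
  Jensen's inequality on \<open>{0..d}\<close>. Integrability of \<open>B \<bar>q\<bar>\<close> is not required, the right side being
  an extended nonnegative integral; nor is that of \<open>q\<close>, since otherwise the integral on the left is
  \<open>0\<close> by convention and \<open>B 0 = 0\<close>.
\<close>
lemma N_function_jensen: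
  fixes q :: "real \<Rightarrow> real"
  assumes B: "N_function B" and d: "0 < d" and q[measurable]: "q \<in> borel_measurable borel"
  shows "ennreal (B (\<bar>\<integral>t. indicator {0..d} t * q t \<partial>lborel\<bar> / d)) \<le>
    ennreal (1 / d) * (\<integral>\<^sup>+t. indicator {0..d} t * ennreal (B \<bar>q t\<bar>) \<partial>lborel)"
proof -
  define m where "m = \<bar>\<integral>t. indicator {0..d} t * q t \<partial>lborel\<bar> / d"
  have "ennreal (B m) \<le> ennreal (1 / d) * (\<integral>\<^sup>+t. indicator {0..d} t * ennreal (B \<bar>q t\<bar>) \<partial>lborel)"
  proof (cases "m = 0")
    case True
    then show ?thesis by (simp add: N_functionD(4)[OF B])
  next
    case False
    then have m: "m > 0" using d by (simp add: m_def)
    have int: "integrable lborel (\<lambda>t. indicator {0..d} t * q t)"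
      using False not_integrable_integral_eq[of lborel "\<lambda>t. indicator {0..d} t * q t"] by (auto simp: m_def)
    \<comment> \<open>the slope of a supporting line of \<open>B\<close> at \<open>m\<close>\<close>
    define k where "k = Inf ((\<lambda>t. (B m - B t) / (m - t)) ` ({m<..} \<inter> {0..}))"
    have k: "B m + k * (y - m) \<le> B y" if "y \<ge> 0" for y
      using convex_le_Inf_differential[OF N_functionD(3)[OF B], of m y] m that
      by (simp add: k_def)
    \<comment> \<open>The supporting line lies below \<open>B 0 = 0\<close> at the origin and is nonnegative at \<open>m > 0\<close>.\<close>
    have k0: "k \<ge> 0"
      using k[of 0] m N_functionD(1)[OF B, of m] N_functionD(4)[OF B]
      by (smt (verit) mult_neg_pos mult_minus_right)
    let ?f = "\<lambda>t. indicator {0..d} t * (B m - k * m) + k * \<bar>indicator {0..d} t * q t\<bar>"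
    have ind: "integrable lborel (indicator {0..d} :: real \<Rightarrow> real)"
      by (rule integrable_real_indicator) (auto simp: emeasure_lborel_Icc_eq)
    have f: "integrable lborel ?f"
      using int ind by simp
    have "d * m \<le> (\<integral>t. \<bar>indicator {0..d} t * q t\<bar> \<partial>lborel)"
      using integral_abs_bound[of lborel "\<lambda>t. indicator {0..d} t * q t"] d by (simp add: m_def)
    then have "k * (d * m) \<le> k * (\<integral>t. \<bar>indicator {0..d} t * q t\<bar> \<partial>lborel)"
      using k0 by (rule mult_left_mono)
    moreover have "(\<integral>t. ?f t \<partial>lborel) = d * (B m - k * m) + k * (\<integral>t. \<bar>indicator {0..d} t * q t\<bar> \<partial>lborel)"
      using int ind d by (subst Bochner_Integration.integral_add) simp_all
    ultimately have "d * B m \<le> (\<integral>t. ?f t \<partial>lborel)"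
      by (simp add: algebra_simps)
    also have "\<dots> \<le> (\<integral>t. max 0 (?f t) \<partial>lborel)"
      using f by (intro integral_mono) auto
    finally have "ennreal (d * B m) \<le> ennreal (\<integral>t. max 0 (?f t) \<partial>lborel)"
      by (rule ennreal_leI)
    also have "\<dots> = (\<integral>\<^sup>+t. ennreal (max 0 (?f t)) \<partial>lborel)"
      using f by (intro nn_integral_eq_integral[symmetric]) auto
    also have "\<dots> \<le> (\<integral>\<^sup>+t. indicator {0..d} t * ennreal (B \<bar>q t\<bar>) \<partial>lborel)"
    proof (rule nn_integral_mono)
      fix t
      show "ennreal (max 0 (?f t)) \<le> indicator {0..d} t * ennreal (B \<bar>q t\<bar>)"
        using k[of "\<bar>q t\<bar>"] N_functionD(1)[OF B, of "\<bar>q t\<bar>"]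
        by (auto simp: indicator_def algebra_simps intro!: ennreal_leI)
    qed
    finally have "ennreal (1 / d) * ennreal (d * B m) \<le>
        ennreal (1 / d) * (\<integral>\<^sup>+t. indicator {0..d} t * ennreal (B \<bar>q t\<bar>) \<partial>lborel)"
      by (rule mult_left_mono) simp
    then show ?thesis
      using d by (simp add: ennreal_mult'[symmetric])
  qed
  then show ?thesis by (simp only: m_def)
qed

lemma nn_integral_ray_average:
  fixes f :: "'a::euclidean_space \<Rightarrow> ennreal"
  assumes d: "0 < d" and [measurable]: "f \<in> borel_measurable borel"
  shows "(\<integral>\<^sup>+x. ennreal (1 / d) * (\<integral>\<^sup>+t. indicator {0..d} t * f (x + t *\<^sub>R e) \<partial>lborel) \<partial>lborel) = (\<integral>\<^sup>+x. f x \<partial>lborel)"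
proof -
  have "(\<integral>\<^sup>+x. (\<integral>\<^sup>+t. indicator {0..d} t * f (x + t *\<^sub>R e) \<partial>lborel) \<partial>lborel) =
      (\<integral>\<^sup>+t. (\<integral>\<^sup>+x. indicator {0..d} t * f (x + t *\<^sub>R e) \<partial>lborel) \<partial>lborel)"
    by (rule lborel_pair.Fubini') measurable
  also have "\<dots> = (\<integral>\<^sup>+t. indicator {0..d} t * (\<integral>\<^sup>+x. f x \<partial>lborel) \<partial>lborel)"
    by (simp add: nn_integral_cmult lborel_nn_integral_translate)
  also have "\<dots> = ennreal d * (\<integral>\<^sup>+x. f x \<partial>lborel)"
    using d by (simp add: nn_integral_multc)
  finally show ?thesis
    using d by (simp add: nn_integral_cmult mult.assoc[symmetric] ennreal_mult'[symmetric])
qed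

lemma orlicz_poincare:
  fixes u :: "'a::euclidean_space \<Rightarrow> real"
  assumes B: "N_function B" and \<Omega>: "open \<Omega>" "bounded \<Omega>"
    and d: "0 < d" "\<And>x. x \<in> \<Omega> \<Longrightarrow> x + d *\<^sub>R e \<notin> \<Omega>" and e: "e \<in> Basis"
    and u: "u \<in> orlicz_sobolev_0 B \<Omega>"
  shows "(\<integral>\<^sup>+x. ennreal (B (1 / d * \<bar>u x\<bar>)) \<partial>lebesgue_on \<Omega>) \<le>
    (\<integral>\<^sup>+x. ennreal (B (norm (weak_gradient \<Omega> u x))) \<partial>lebesgue_on \<Omega>)"
proof -
  obtain p where p: "integrable lborel p" "\<And>x. x \<notin> \<Omega> \<Longrightarrow> p x = 0"
    and pg: "AE x in lborel. x \<in> \<Omega> \<longrightarrow> weak_gradient \<Omega> u x \<bullet> e = p x"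
    and pu: "AE x in lborel. x \<in> \<Omega> \<longrightarrow> u x = - ray_integral d e p x"
    by (rule orlicz_sobolev_0_ray_integral[OF B \<Omega> less_imp_le[OF d(1)] d(2) e u]) (assumption, rule that)
  have [measurable]: "p \<in> borel_measurable borel" using p(1) by auto
  note N_function_abs_measurable[OF B, measurable]
  have "(\<integral>\<^sup>+x. ennreal (B (1 / d * \<bar>u x\<bar>)) \<partial>lebesgue_on \<Omega>) =
      (\<integral>\<^sup>+x. ennreal (B (1 / d * \<bar>u x\<bar>)) * indicator \<Omega> x \<partial>lborel)"
    by (rule nn_integral_lebesgue_on_open[OF \<Omega>(1)])
  also have "\<dots> \<le> (\<integral>\<^sup>+x. ennreal (1 / d) * (\<integral>\<^sup>+t. indicator {0..d} t * ennreal (B \<bar>p (x + t *\<^sub>R e)\<bar>) \<partial>lborel) \<partial>lborel)"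
  proof (rule nn_integral_mono_AE)
    show "AE x in lborel. ennreal (B (1 / d * \<bar>u x\<bar>)) * indicator \<Omega> x \<le>
        ennreal (1 / d) * (\<integral>\<^sup>+t. indicator {0..d} t * ennreal (B \<bar>p (x + t *\<^sub>R e)\<bar>) \<partial>lborel)"
      using pu
    proof eventually_elim
      case (elim x)
      then show ?case
        using N_function_jensen[OF B d(1), of "\<lambda>t. p (x + t *\<^sub>R e)"]
        by (auto simp: indicator_def[of \<Omega>] ray_integral_def)
    qed
  qed
  also have "\<dots> = (\<integral>\<^sup>+x. ennreal (B \<bar>p x\<bar>) \<partial>lborel)"
    by (rule nn_integral_ray_average[OF d(1)]) measurable
  also have "\<dots> \<le> (\<integral>\<^sup>+x. ennreal (B (norm (weak_gradient \<Omega> u x))) * indicator \<Omega> x \<partial>lborel)"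
  proof (rule nn_integral_mono_AE)
    show "AE x in lborel. ennreal (B \<bar>p x\<bar>) \<le> ennreal (B (norm (weak_gradient \<Omega> u x))) * indicator \<Omega> x"
      using pg
    proof eventually_elim
      case (elim x)
      show ?case
      proof (cases "x \<in> \<Omega>")
        case True
        then have "\<bar>p x\<bar> \<le> norm (weak_gradient \<Omega> u x)"
          using elim Basis_le_norm[OF e, of "weak_gradient \<Omega> u x"] by simp
        then show ?thesis
          using True by (simp add: ennreal_leI N_functionD(2)[OF B])
      qed (simp add: p(2) N_functionD(4)[OF B])
    qed
  qed
  also have "\<dots> = (\<integral>\<^sup>+x. ennreal (B (norm (weak_gradient \<Omega> u x))) \<partial>lebesgue_on \<Omega>)"
    by (rule nn_integral_lebesgue_on_open[OF \<Omega>(1), symmetric])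
  finally show ?thesis .
qed

lemma bounded_exit_time:
  fixes \<Omega> :: "'a::real_normed_vector set"
  assumes "bounded \<Omega>" and e: "norm e = 1"
  obtains d where "0 < d" "\<And>x. x \<in> \<Omega> \<Longrightarrow> x + d *\<^sub>R e \<notin> \<Omega>"
proof -
  obtain R where R: "0 < R" "\<And>x. x \<in> \<Omega> \<Longrightarrow> norm x \<le> R"
    using assms(1) bounded_pos by metis
  have "x + (2 * R + 1) *\<^sub>R e \<notin> \<Omega>" if "x \<in> \<Omega>" for x
  proof
    assume "x + (2 * R + 1) *\<^sub>R e \<in> \<Omega>"
    then have "norm (x + (2 * R + 1) *\<^sub>R e) \<le> R" "norm x \<le> R"
      using R(2) that by auto
    moreover have "norm ((2 * R + 1) *\<^sub>R e) \<le> norm (x + (2 * R + 1) *\<^sub>R e) + norm x"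
      by (metis add_diff_cancel_left' norm_triangle_ineq4)
    ultimately show False using R(1) e by simp
  qed
  then show thesis using that[of "2 * R + 1"] R(1) by simp
qed

theorem corollary4p1:
  fixes \<Omega> :: "(real ^ 'n) set"
  assumes "bounded \<Omega>" and "lipschitz_domain \<Omega>"
  shows "\<exists>c1>0. \<exists>c2>0. \<forall>B. N_function B \<longrightarrow>
    (\<forall>u\<in>orlicz_sobolev_0 B \<Omega>.
       (\<integral>\<^sup>+x. ennreal (B (c1 * \<bar>u x\<bar>)) \<partial>lebesgue_on \<Omega>)
         \<le> ennreal c2 * (\<integral>\<^sup>+x. ennreal (B (norm (weak_gradient \<Omega> u x))) \<partial>lebesgue_on \<Omega>))"
proof -
  obtain e :: "real ^ 'n" where e: "e \<in> Basis"
    using nonempty_Basis by blast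
  obtain d where d: "0 < d" "\<And>x. x \<in> \<Omega> \<Longrightarrow> x + d *\<^sub>R e \<notin> \<Omega>"
    using bounded_exit_time[OF assms(1) norm_Basis[OF e]] by blast
  have "open \<Omega>" using assms(2) by (simp add: lipschitz_domain_def)
  then show ?thesis
    using orlicz_poincare[OF _ _ assms(1) d e] d(1)
    by (intro exI[of _ "1 / d"] exI[of _ 1] conjI allI impI ballI) simp_all
qed

end
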